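(* Let $\hat\sigma(T,K;\overline p)$ be an implied volatility parametrization on the parameter domain $\mathcal D$ which is continuously differentiable in $T$ and $K$, and let $\hat\sigma(T,K;\overline p^*,N_q)$ be its discretized randomization with quadrature pairs $\{\lambda_n,\theta_n\}_{n=1}^{N_q}$. Fix $(T,K)$ with $T>0$, $K>0$, put $\eta_n:=\hat\sigma(T,K;\overline p(\theta_n))$ and assume $\eta_n>0$ for all $n$. Let $m(T,K):=\log\frac{S_0}{K}+rT$, and let $P=P_{(T,K)}$ be the positive function of a real variable $m$ determined by $f(m,P(m))=g(m)$, with $f,g$ as in the context. Then $$\hat\sigma(T,K;\overline p^*,N_q)=P_{(T,K)}\bigl(m(T,K)\bigr),$$ the function $P$ is represented by its Taylor series at $0$ on the domain of convergence $A\subset\mathbb R$ of that series (so that, if $m(T,K)\in A$, $\hat\sigma(T,K;\overline p^*,N_q)$ is the value of this series at $m(T,K)$), and, as $m\to0$, $$P(m)=P(0)+\frac{P^{(2)}(0)}{2!}m^2+\frac{P^{(4)}(0)}{4!}m^4+\frac{P^{(6)}(0)}{6!}m^6+\mathcal O(m^8),$$ where $$P(0)=\frac{2}{\sqrt T}\,\Phi^{-1}\left(\sum_{n=1}^{N_q}\lambda_n\Phi\left(\tfrac12\eta_n\sqrt T\right)\right),$$ $$P^{(2)}(0)=\frac{1}{2\sqrt T}\left\{-\frac1{\Sigma_0}+\sum_{n=1}^{N_q}\lambda_n\frac{E_n}{H_n}\right\},$$ $$P^{(4)}(0)=\frac1{8\sqrt T}\left\{\frac{1+6\Sigma_2+\Sigma_0^2\left(-7-6\Sigma_2+3\Sigma_2^2\right)}{\Sigma_0^3}+\sum_{n=1}^{N_q}\lambda_n\left[\frac{E_n}{H_n^3}\left(-1+7H_n^2\right)\right]\right\},$$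 $$\begin{aligned}P^{(6)}(0)=\frac1{32\sqrt T}\Bigg\{&\frac{-3-45\Sigma_2+\Sigma_0^2\left(90\Sigma_2+60\Sigma_4\right)+\Sigma_0^4\Sigma_2\left(45\Sigma_2+60\Sigma_4-15\Sigma_2^2\right)}{\Sigma_0^5}\\&+\frac{16\Sigma_0^2-90\Sigma_2^2-31\Sigma_0^4-45\Sigma_0^2\Sigma_2^2-\Sigma_0^4\left(15\Sigma_2+60\Sigma_4\right)+15\Sigma_0^2\Sigma_2^3}{\Sigma_0^5}\\&+\sum_{n=1}^{N_q}\lambda_n\left[\frac{E_n}{H_n^5}\left(3-16H_n^2+31H_n^4\right)\right]\Bigg\},\end{aligned}$$ with $$\Sigma_0:=\tfrac12P(0)\sqrt T,\quad \Sigma_2:=P(0)P^{(2)}(0)T,\quad \Sigma_4:=P(0)P^{(4)}(0)T,\quad H_n:=\tfrac12\eta_n\sqrt T,\quad E_n:=\exp\left(\tfrac12(\Sigma_0^2-H_n^2)\right).$$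
   Context: Current time is $t_0=0$; $S_0>0$ is the spot price and $r$ the constant risk-free rate. $\Phi$ is the standard normal cumulative distribution function. $BS_{c/p}(t_0,S_0,T,K;\sigma)$ is the Black-Scholes call/put price with expiry $T$, strike $K$ and volatility $\sigma$. An implied volatility parametrization assigns to each $\overline p=(p_1,\dots,p_m)\in\mathcal D\subset\mathbb R^m$ a surface $(T,K)\mapsto\hat\sigma(T,K;\overline p)\ge0$, with prices $V_{c/p}(T,K;\overline p)=BS_{c/p}(t_0,S_0,T,K;\hat\sigma(T,K;\overline p))$. One parameter, the $i$-th, is randomized by a real random variable $\vartheta$; $\overline p(\theta)$ denotes $\overline p$ with $i$-th entry replaced by $\theta$, and $\overline p^*$ collects the remaining parameters together with those of the law of $\vartheta$. The pairs $\{\lambda_n,\theta_n\}_{n=1}^{N_q}$ are the Gauss quadrature weights and nodes of $\vartheta$, i.e. $\mathbb E[h(\vartheta)]=\sum_n\lambda_nh(\theta_n)$ for all polynomials $h$ of degree less than $2N_q$ (in particular $\lambda_n\ge0$ and $\sum_n\lambda_n=1$), and $\overline p(\theta_n)\in\mathcal D$. The discretized randomization $\hat\sigma(T,K;\overline p^*,N_q)$ is the Black-Scholes implied volatility of the price $\sum_{n=1}^{N_q}\lambda_nV_{c/p}(T,K;\overline p(\theta_n))$. For fixed $(T,K)$ (with $\eta_n=\hat\sigma(T,K;\overline p(\theta_n))$ held fixed as $m$ varies), the functions $f,g$ are, for $m\in\mathbb R$, $y>0$, $$f(m,y):=S_0\left[\Phi\left(\frac{m+\frac12y^2T}{y\sqrt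 T}\right)-e^{-m}\Phi\left(\frac{m-\frac12y^2T}{y\sqrt T}\right)\right],$$ $$g(m):=S_0\sum_{n=1}^{N_q}\lambda_n\left[\Phi\left(\frac{m+\frac12\eta_n^2T}{\eta_n\sqrt T}\right)-e^{-m}\Phi\left(\frac{m-\frac12\eta_n^2T}{\eta_n\sqrt T}\right)\right].$$ $\mathcal O(m^8)$ means a remainder $R(m)$ with $|R(m)|\le C m^8$ for some constant $C$ and all sufficiently small $|m|$. *)

theory Defs
  imports "HOL-Probability.Probability" "HOL-Library.Landau_Symbols"
    "HOL-Computational_Algebra.Polynomial"
begin

abbreviation Phi :: "real \<Rightarrow> real"
  where "Phi \<equiv> cdf std_normal_distribution"

text \<open>\<open>Phi\<close> is injective with range \<open>{0<..<1}\<close>, so \<open>inv Phi\<close> is the usual quantile function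
  there.\<close>
abbreviation Phi_inv :: "real \<Rightarrow> real"
  where "Phi_inv \<equiv> inv Phi"

datatype option_kind = Call | Put

text \<open>The case \<open>\<sigma> = 0\<close> is the limit of the formula as \<open>\<sigma>\<close> tends to 0 from the right, i.e. the
  discounted payoff on the forward; it is separated because of the convention \<open>x / 0 = 0\<close>.\<close>
definition BS ::
  "real \<Rightarrow> option_kind \<Rightarrow> real \<Rightarrow> real \<Rightarrow> real \<Rightarrow> real \<Rightarrow> real \<Rightarrow> real"
  where "BS r cp t0 S0 T K \<sigma> =
    (let \<tau> = T - t0;
         d1 = (ln (S0 / K) + (r + \<sigma>\<^sup>2 / 2) * \<tau>) / (\<sigma> * sqrt \<tau>);
         d2 = (ln (S0 / K) + (r - \<sigma>\<^sup>2 / 2) * \<tau>) / (\<sigma> * sqrt \<tau>)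
     in case cp of
          Call \<Rightarrow>
            if \<sigma> = 0 then max (S0 - K * exp (- r * \<tau>)) 0
            else S0 * Phi d1 - K * exp (- r * \<tau>) * Phi d2
        | Put \<Rightarrow>
            if \<sigma> = 0 then max (K * exp (- r * \<tau>) - S0) 0
            else K * exp (- r * \<tau>) * Phi (- d2) - S0 * Phi (- d1))"

definition implied_vol ::
  "real \<Rightarrow> option_kind \<Rightarrow> real \<Rightarrow> real \<Rightarrow> real \<Rightarrow> real \<Rightarrow> real \<Rightarrow> real"
  where "implied_vol r cp t0 S0 T K V = (THE \<sigma>. \<sigma> \<ge> 0 \<and> BS r cp t0 S0 T K \<sigma> = V)"

text \<open>Surfaces live on maturities \<open>T > 0\<close> (the current time being 0) and strikes \<open>K > 0\<close>.\<close>
definition iv_parametrization ::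
  "(real ^ 'm) set \<Rightarrow> (real \<Rightarrow> real \<Rightarrow> real ^ 'm \<Rightarrow> real) \<Rightarrow> bool"
  where "iv_parametrization D \<sigma> \<longleftrightarrow> (\<forall>p\<in>D. \<forall>T>0. \<forall>K>0. \<sigma> T K p \<ge> 0)"

definition continuously_differentiable_in_T_K ::
  "(real ^ 'm) set \<Rightarrow> (real \<Rightarrow> real \<Rightarrow> real ^ 'm \<Rightarrow> real) \<Rightarrow> bool"
  where "continuously_differentiable_in_T_K D \<sigma> \<longleftrightarrow>
    (\<forall>p\<in>D. \<exists>DT DK :: real \<times> real \<Rightarrow> real.
       continuous_on ({0<..} \<times> {0<..}) DT \<and> continuous_on ({0<..} \<times> {0<..}) DK \<and>
       (\<forall>T>0. \<forall>K>0.
          ((\<lambda>t. \<sigma> t K p) has_real_derivative DT (T, K)) (at T) \<and>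
          ((\<lambda>k. \<sigma> T k p) has_real_derivative DK (T, K)) (at K)))"

definition replace_param :: "real ^ 'm \<Rightarrow> 'm \<Rightarrow> real \<Rightarrow> real ^ 'm"
  where "replace_param p i \<theta> = (\<chi> j. if j = i then \<theta> else p $ j)"

text \<open>Nonnegativity of the weights follows from exactness if the nodes are distinct (test with the
  squares of the Lagrange polynomials). It is listed so that distinctness need not be imposed.
  That the weights sum to 1 is the case of the constant polynomial 1.\<close>
definition gauss_quadrature ::
  "'w measure \<Rightarrow> ('w \<Rightarrow> real) \<Rightarrow> nat \<Rightarrow> (nat \<Rightarrow> real) \<Rightarrow> (nat \<Rightarrow> real) \<Rightarrow> bool"
  where "gauss_quadrature M X N w \<theta> \<longleftrightarrow>
    (\<forall>n\<in>{1..N}. w n \<ge> 0) \<and>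
    (\<forall>h :: real poly. degree h < 2 * N \<longrightarrow>
       integrable M (\<lambda>\<omega>. poly h (X \<omega>)) \<and>
       (\<integral>\<omega>. poly h (X \<omega>) \<partial>M) = (\<Sum>n=1..N. w n * poly h (\<theta> n)))"

definition discretized_randomization ::
  "real \<Rightarrow> option_kind \<Rightarrow> real \<Rightarrow> (real \<Rightarrow> real \<Rightarrow> real ^ 'm \<Rightarrow> real) \<Rightarrow> real ^ 'm \<Rightarrow> 'm \<Rightarrow>
   (nat \<Rightarrow> real) \<Rightarrow> (nat \<Rightarrow> real) \<Rightarrow> nat \<Rightarrow> real \<Rightarrow> real \<Rightarrow> real"
  where "discretized_randomization r cp S0 \<sigma> p i w \<theta> N T K =
    implied_vol r cp 0 S0 T K
      (\<Sum>n=1..N. w n * BS r cp 0 S0 T K (\<sigma> T K (replace_param p i (\<theta> n))))"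

definition f_price :: "real \<Rightarrow> real \<Rightarrow> real \<Rightarrow> real \<Rightarrow> real"
  where "f_price S0 T m y =
    S0 * (Phi ((m + y\<^sup>2 * T / 2) / (y * sqrt T)) - exp (- m) * Phi ((m - y\<^sup>2 * T / 2) / (y * sqrt T)))"

definition g_price ::
  "real \<Rightarrow> real \<Rightarrow> nat \<Rightarrow> (nat \<Rightarrow> real) \<Rightarrow> (nat \<Rightarrow> real) \<Rightarrow> real \<Rightarrow> real"
  where "g_price S0 T N w \<eta> m =
    S0 * (\<Sum>n=1..N. w n *
      (Phi ((m + (\<eta> n)\<^sup>2 * T / 2) / (\<eta> n * sqrt T))
        - exp (- m) * Phi ((m - (\<eta> n)\<^sup>2 * T / 2) / (\<eta> n * sqrt T))))"

end

theory Submission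
  imports Defs "HOL-Complex_Analysis.Complex_Analysis" "HOL-Real_Asymp.Real_Asymp"
begin

text \<open>
  With total volatilities \<open>s = P(m) \<surd>T\<close> and \<open>v\<^sub>n = \<eta>\<^sub>n \<surd>T\<close> the defining equation says that the
  normalised call price with volatility \<open>s\<close> is the mixture of those with volatilities \<open>v\<^sub>n\<close>. Since
  vega is positive, \<open>s\<close> exists, is unique and, by the holomorphic implicit function theorem, real
  analytic on the whole line; analytic continuation along the real line and Abel's theorem at the
  end points then give the Taylor series on all of its domain of convergence. Put-call symmetry
  makes \<open>s\<close> even. Differentiating the equation once gives
  \<open>\<Phi>(d\<^sub>2) + \<phi>(d\<^sub>2) s' = \<Sum>\<^sub>n w\<^sub>n \<Phi>(d\<^sub>2\<^sub>,\<^sub>n)\<close>, and once more a second order differential equation in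
  which the normal distribution function no longer occurs. Comparing its power series coefficients
  of orders 0, 2 and 4 yields the derivatives of orders 2, 4 and 6.
\<close>

section \<open>Real analytic functions via holomorphic extensions\<close>

text \<open>Smoothness would give the expansion with remainder, but equality with the Taylor series
  on its whole domain of convergence needs analyticity at every real point, as nothing is known in
  advance about the radius of convergence. The complex extensions of the total volatility are only
  local, although the series lives on a disc; hence the continuation runs along the real axis.
  Analyticity holds at every real m because vega is a Gaussian density, whose complex extension is
  an exponential and has no zeros. The second differentiation pays off after division by the density
  at d_2. In (m/v - v/2)^2 the cross term is -m whatever v is, so quotients of such densities are
  exponentials in which m occurs only as m^2. The differential equation therefore respects evenness,
  and the weights enter the coefficients used only through the sums of w_n E_n / H_n^j for j = 1, 3,
  5, where E_n is the quotient of the two densities at m = 0. The quantities Sigma_2 and Sigma_4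
  carry the lower derivatives, which are kept as unknowns instead of being substituted.\<close>

text \<open>Newton's map with frozen derivative, \<open>y - F z y / c\<close>, contracts by 1/2
  uniformly in \<open>z\<close> near \<open>z0\<close>. Its iterates from the constant
  \<open>y0\<close> are holomorphic in \<open>z\<close> and converge uniformly, so the fixed point
  is holomorphic too. Assumption \<open>hol\<close> replaces joint holomorphy of \<open>F\<close> by
  holomorphy along holomorphic curves, which is what the iteration asks for.\<close>

lemma holomorphic_implicit_function:
  fixes F F' :: "complex \<Rightarrow> complex \<Rightarrow> complex"
  assumes W: "open W" "(z0, y0) \<in> W"
    and hol: "\<And>y A. open A \<Longrightarrow> y holomorphic_on A \<Longrightarrow> (\<And>z. z \<in> A \<Longrightarrow> (z, y z) \<in> W) \<Longrightarrow>
      (\<lambda>z. F z (y z)) holomorphic_on A"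
    and der: "\<And>z y. (z, y) \<in> W \<Longrightarrow> (F z has_field_derivative F' z y) (at y)"
    and cont: "continuous_on W (\<lambda>(z, y). F' z y)"
    and zero: "F z0 y0 = 0" and nz: "F' z0 y0 \<noteq> 0"
  obtains h \<delta> \<epsilon> where "\<delta> > 0" "\<epsilon> > 0" "h holomorphic_on ball z0 \<delta>"
    "\<And>z y. z \<in> ball z0 \<delta> \<Longrightarrow> y \<in> cball y0 \<epsilon> \<Longrightarrow> F z y = 0 \<longleftrightarrow> y = h z"
proof -
  define c where "c = F' z0 y0"
  have c: "c \<noteq> 0" using nz by (simp add: c_def)
  have "isCont (\<lambda>x. F' (fst x) (snd x)) (z0, y0)"
    using cont W by (simp add: continuous_on_eq_continuous_at case_prod_unfold)
  then have "(\<lambda>x. 1 - F' (fst x) (snd x) / c) \<midarrow>(z0, y0)\<rightarrow> 1 - c / c"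
    unfolding isCont_def using c by (intro tendsto_intros) (auto simp: c_def)
  then have "\<forall>\<^sub>F x in at (z0, y0). norm (1 - F' (fst x) (snd x) / c) < 1/2"
    using c by (auto simp: tendsto_iff dist_norm elim!: allE[where x = "1/2"])
  then have "\<forall>\<^sub>F x in nhds (z0, y0). norm (1 - F' (fst x) (snd x) / c) < 1/2"
    using c by (auto simp: eventually_nhds_conv_at c_def)
  moreover have "\<forall>\<^sub>F x in nhds (z0, y0). x \<in> W"
    using W by (rule eventually_nhds_in_open)
  ultimately have "\<forall>\<^sub>F x in nhds z0 \<times>\<^sub>F nhds y0. x \<in> W \<and> norm (1 - F' (fst x) (snd x) / c) < 1/2"
    unfolding nhds_prod [symmetric] by eventually_elim auto
  then obtain Q R where Q: "eventually Q (nhds z0)" and R: "eventually R (nhds y0)"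
    and QR: "\<And>z y. Q z \<Longrightarrow> R y \<Longrightarrow> (z, y) \<in> W \<and> norm (1 - F' z y / c) < 1/2"
    unfolding eventually_prod_filter by auto
  obtain \<epsilon> where \<epsilon>: "\<epsilon> > 0" "\<And>y. y \<in> cball y0 \<epsilon> \<Longrightarrow> R y"
    using R unfolding eventually_nhds_metric_le by (auto simp: dist_commute)
  obtain \<delta>1 where \<delta>1: "\<delta>1 > 0" "\<And>z. z \<in> ball z0 \<delta>1 \<Longrightarrow> Q z"
    using Q unfolding eventually_nhds_metric by (auto simp: dist_commute)
  have y0: "y0 \<in> cball y0 \<epsilon>" using \<epsilon>(1) by simp
  have inW: "(z, y) \<in> W" if "z \<in> ball z0 \<delta>1" "y \<in> cball y0 \<epsilon>" for z y
    using QR \<epsilon>(2) \<delta>1(2) that by blast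
  have "(\<lambda>z. F z y0) holomorphic_on ball z0 \<delta>1"
    by (rule hol) (use inW y0 in auto)
  then have "isCont (\<lambda>z. F z y0) z0"
    using \<delta>1(1) by (meson centre_in_ball continuous_on_eq_continuous_at holomorphic_on_imp_continuous_on open_ball)
  then have "(\<lambda>z. F z y0 / c) \<midarrow>z0\<rightarrow> F z0 y0 / c"
    unfolding isCont_def using c by (intro tendsto_intros) auto
  \<comment> \<open>The bound \<open>\<epsilon> / 2\<close> is the room left by the contraction
    factor 1/2: images of the closed ball of radius \<open>\<epsilon>\<close> stay within
    \<open>\<epsilon> / 2 + \<epsilon> / 2\<close> of \<open>y0\<close>.\<close>
  then have "\<forall>\<^sub>F z in at z0. norm (F z y0 / c) < \<epsilon> / 2"
    using \<epsilon>(1) zero by (auto simp: tendsto_iff dist_norm elim!: allE[where x = "\<epsilon>/2"])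
  then have "\<forall>\<^sub>F z in nhds z0. norm (F z y0 / c) < \<epsilon> / 2"
    using \<epsilon>(1) zero by (auto simp: eventually_nhds_conv_at)
  then obtain \<delta>2 where \<delta>2: "\<delta>2 > 0" "\<And>z. z \<in> ball z0 \<delta>2 \<Longrightarrow> norm (F z y0 / c) < \<epsilon> / 2"
    unfolding eventually_nhds_metric by (auto simp: dist_commute)
  define \<delta> where "\<delta> = min \<delta>1 \<delta>2"
  have \<delta>: "\<delta> > 0" "ball z0 \<delta> \<subseteq> ball z0 \<delta>1" "ball z0 \<delta> \<subseteq> ball z0 \<delta>2"
    using \<delta>1(1) \<delta>2(1) by (auto simp: \<delta>_def)
  define G where "G = (\<lambda>z y. y - F z y / c)"
  have contr: "dist (G z x) (G z y) \<le> 1/2 * dist x y"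
    if "z \<in> ball z0 \<delta>" "x \<in> cball y0 \<epsilon>" "y \<in> cball y0 \<epsilon>" for z x y
    unfolding dist_norm
  proof (rule field_differentiable_bound [where S = "cball y0 \<epsilon>" and f' = "\<lambda>y. 1 - F' z y / c"])
    fix u assume u: "u \<in> cball y0 \<epsilon>"
    then have "(z, u) \<in> W" "norm (1 - F' z u / c) < 1/2"
      using QR[OF \<delta>1(2) \<epsilon>(2)[OF u], of z] that(1) \<delta>(2) by auto
    then have "(G z has_field_derivative 1 - F' z u / c) (at u)"
      unfolding G_def by (intro DERIV_diff DERIV_ident DERIV_cdivide der)
    then show "(G z has_field_derivative 1 - F' z u / c) (at u within cball y0 \<epsilon>)"
      by (rule has_field_derivative_at_within)
    show "norm (1 - F' z u / c) \<le> 1/2" using \<open>norm (1 - F' z u / c) < 1/2\<close> by simp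
  qed (use that in auto)
  have maps: "G z y \<in> cball y0 \<epsilon>" if "z \<in> ball z0 \<delta>" "y \<in> cball y0 \<epsilon>" for z y
  proof -
    have "dist (G z y) y0 \<le> dist (G z y) (G z y0) + dist (G z y0) y0"
      by (rule dist_triangle)
    also have "dist (G z y) (G z y0) \<le> 1/2 * \<epsilon>"
      using contr[OF that y0] that(2) by (simp add: dist_commute)
    also have "dist (G z y0) y0 \<le> \<epsilon> / 2"
      using \<delta>2(2)[of z] that(1) \<delta>(3) by (auto simp: G_def dist_norm norm_minus_commute)
    finally show ?thesis by (simp add: dist_commute)
  qed
  have "\<exists>!y\<in>cball y0 \<epsilon>. G z y = y" if "z \<in> ball z0 \<delta>" for z
    by (rule Banach_fix [where c = "1/2"]) (use that maps contr y0 compact_imp_complete[OF compact_cball[of y0 \<epsilon>]] in auto)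
  then obtain h where h: "\<And>z. z \<in> ball z0 \<delta> \<Longrightarrow> h z \<in> cball y0 \<epsilon> \<and> G z (h z) = h z"
    and uniq: "\<And>z y. z \<in> ball z0 \<delta> \<Longrightarrow> y \<in> cball y0 \<epsilon> \<Longrightarrow> G z y = y \<Longrightarrow> y = h z"
    by metis
  define it where "it = (\<lambda>n z. (G z ^^ n) y0)"
  have it_in: "it n z \<in> cball y0 \<epsilon>" if "z \<in> ball z0 \<delta>" for n z
    by (induction n) (use maps that y0 in \<open>auto simp: it_def simp del: mem_cball\<close>)
  have it_hol: "it n holomorphic_on ball z0 \<delta>" for n
  proof (induction n)
    case (Suc n)
    have "(\<lambda>z. it n z - F z (it n z) / c) holomorphic_on ball z0 \<delta>"
      using c by (intro holomorphic_intros Suc hol) (use inW it_in \<delta>(2) in auto)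
    then show ?case by (simp add: it_def G_def)
  qed (simp add: it_def)
  have it_dist: "dist (it n z) (h z) \<le> \<epsilon> * (1/2) ^ n" if "z \<in> ball z0 \<delta>" for n z
  proof (induction n)
    case 0
    then show ?case using h[OF that] by (simp add: it_def)
  next
    case (Suc n)
    have "dist (it (Suc n) z) (h z) = dist (G z (it n z)) (G z (h z))"
      using h[OF that] by (simp add: it_def)
    also have "\<dots> \<le> 1/2 * dist (it n z) (h z)"
      by (rule contr) (use that it_in h in auto)
    finally show ?case using Suc by simp
  qed
  have "uniform_limit (ball z0 \<delta>) it h sequentially"
  proof (rule uniform_limitI)
    fix e :: real assume "e > 0"
    have "(\<lambda>n. \<epsilon> * (1/2) ^ n) \<longlonglongrightarrow> \<epsilon> * 0"
      by (intro tendsto_intros LIMSEQ_realpow_zero) auto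
    then have "\<forall>\<^sub>F n in sequentially. \<epsilon> * (1/2) ^ n < e"
      using \<open>e > 0\<close> by (intro order_tendstoD(2)[where y = "\<epsilon> * 0"]) auto
    then show "\<forall>\<^sub>F n in sequentially. \<forall>z\<in>ball z0 \<delta>. dist (it n z) (h z) < e"
      by eventually_elim (meson it_dist le_less_trans)
  qed
  then have ulim: "uniform_limit (cball x d) it h sequentially" if "cball x d \<subseteq> ball z0 \<delta>" for x d
    using that uniform_limit_on_subset by blast
  have hol_h: "h holomorphic_on ball z0 \<delta>"
  proof (rule holomorphic_uniform_sequence[OF open_ball it_hol])
    fix x assume "x \<in> ball z0 \<delta>"
    then obtain d where "d > 0" "cball x d \<subseteq> ball z0 \<delta>"
      by (meson open_ball open_contains_cball)
    with ulim show "\<exists>d>0. cball x d \<subseteq> ball z0 \<delta> \<and> uniform_limit (cball x d) it h sequentially"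
      by blast
  qed
  have "F z y = 0 \<longleftrightarrow> y = h z" if "z \<in> ball z0 \<delta>" "y \<in> cball y0 \<epsilon>" for z y
    using h[OF that(1)] uniq[OF that] c by (auto simp: G_def)
  then show ?thesis using that \<delta>(1) \<epsilon>(1) hol_h by blast
qed

text \<open>Real analyticity of \<open>f\<close> at \<open>x\<close>, witnessed by a complex germ
  \<open>h\<close>. Keeping \<open>h\<close> visible allows derivatives and power series to be
  computed on the complex side and carried back to \<open>f\<close>.\<close>

definition real_extends_at :: "(complex \<Rightarrow> complex) \<Rightarrow> (real \<Rightarrow> real) \<Rightarrow> real \<Rightarrow> bool"
  where "real_extends_at h f x \<longleftrightarrow>
    h analytic_on {of_real x} \<and> (\<forall>\<^sub>F y in nhds x. h (of_real y) = of_real (f y))"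

lemma real_extends_at_deriv:
  assumes "real_extends_at h f x"
  shows "f field_differentiable at x" and "real_extends_at (deriv h) (deriv f) x"
proof -
  have an: "h analytic_on {of_real x}" and ev: "\<forall>\<^sub>F y in nhds x. h (of_real y) = of_real (f y)"
    using assms by (auto simp: real_extends_at_def)
  obtain S where S: "open S" "complex_of_real x \<in> S" "h holomorphic_on S"
    using an by (auto simp: analytic_at)
  have evS: "\<forall>\<^sub>F y in nhds x. complex_of_real y \<in> S"
  proof -
    have "filterlim complex_of_real (nhds (of_real x)) (nhds x)"
      by (intro tendsto_of_real filterlim_ident)
    then show ?thesis
      using eventually_nhds_in_open[OF S(1,2)] by (auto simp: filterlim_iff)
  qed
  \<comment> \<open>\<open>eventually_eventually\<close> turns agreement near \<open>x\<close> into
    agreement near every \<open>y\<close> close to \<open>x\<close>; differentiation at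
    \<open>y\<close> requires the latter.\<close>
  have *: "\<forall>\<^sub>F y in nhds x. (f has_field_derivative Re (deriv h (of_real y))) (at y) \<and>
      deriv h (of_real y) = of_real (Re (deriv h (of_real y)))"
    using evS eventually_eventually[of "\<lambda>y. h (of_real y) = of_real (f y)" x, THEN iffD2, OF ev]
  proof eventually_elim
    case (elim y)
    let ?d = "deriv h (of_real y)"
    have "(h has_field_derivative ?d) (at (of_real y))"
      using S elim(1) by (intro holomorphic_derivI)
    then have "((\<lambda>t. h (of_real t)) has_vector_derivative ?d) (at y)"
      by (rule has_vector_derivative_real_field)
    then have vd: "((\<lambda>t. of_real (f t)) has_vector_derivative ?d) (at y)"
      using elim(2) by (subst (asm) has_vector_derivative_cong_ev
          [where g = "\<lambda>t. of_real (f t)" and S = UNIV])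
        (auto elim: eventually_mono dest: eventually_nhds_x_imp_x)
    have re: "((\<lambda>t. Re (of_real (f t))) has_vector_derivative Re ?d) (at y)"
      by (rule bounded_linear.has_vector_derivative[OF bounded_linear_Re vd])
    have "((\<lambda>t. Im (of_real (f t))) has_vector_derivative Im ?d) (at y)"
      by (rule bounded_linear.has_vector_derivative[OF bounded_linear_Im vd])
    then have "Im ?d = 0"
      using vector_derivative_unique_at[of "\<lambda>_. 0" "Im ?d" y 0] by simp
    with re show ?case
      by (simp add: has_real_derivative_iff_has_vector_derivative complex_eq_iff)
  qed
  show "f field_differentiable at x"
    using eventually_nhds_x_imp_x[OF *] by (auto simp: field_differentiable_def)
  show "real_extends_at (deriv h) (deriv f) x"
    unfolding real_extends_at_def
  proof
    show "deriv h analytic_on {of_real x}" using an by (rule analytic_deriv)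
    show "\<forall>\<^sub>F y in nhds x. deriv h (of_real y) = of_real (deriv f y)"
      using * by eventually_elim (metis DERIV_imp_deriv)
  qed
qed

lemma real_extends_at_higher_deriv:
  assumes "real_extends_at h f x"
  shows "real_extends_at ((deriv ^^ k) h) ((deriv ^^ k) f) x"
  by (induction k) (use assms real_extends_at_deriv in auto)

lemma real_extends_at_fps_expansion:
  assumes "real_extends_at h f 0"
  shows "h has_fps_expansion fps_expansion h 0"
    and "fps_nth (fps_expansion h 0) k = of_real ((deriv ^^ k) f 0 / fact k)"
proof -
  show "h has_fps_expansion fps_expansion h 0"
    using assms by (intro analytic_at_imp_has_fps_expansion_0) (auto simp: real_extends_at_def)
  have "(deriv ^^ k) h (of_real 0) = of_real ((deriv ^^ k) f 0)"
    using real_extends_at_higher_deriv[OF assms, of k]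
    by (auto simp: real_extends_at_def dest: eventually_nhds_x_imp_x)
  then show "fps_nth (fps_expansion h 0) k = of_real ((deriv ^^ k) f 0 / fact k)"
    by (simp add: fps_expansion_def)
qed

text \<open>Zeros of the difference that accumulate at \<open>x\<close> along the real axis force it
  to vanish near \<open>x\<close>. Assumption \<open>freq\<close> is weak on purpose: in a
  continuation argument, agreement may be known on one side of \<open>x\<close> only.\<close>

lemma analytic_eq_near_real_point:
  fixes h1 h2 :: "complex \<Rightarrow> complex"
  assumes an: "h1 analytic_on {of_real x}" "h2 analytic_on {of_real x}"
    and freq: "\<exists>\<^sub>F y in at x. h1 (of_real y) = h2 (of_real y)"
  shows "\<forall>\<^sub>F z in nhds (of_real x). h1 z = h2 z"
proof -
  define d where "d = (\<lambda>z. h1 z - h2 z)"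
  have d: "d analytic_on {of_real x}" unfolding d_def by (intro analytic_intros an)
  have lim: "filterlim complex_of_real (at (of_real x)) (at x)"
    unfolding filterlim_at by (auto intro!: tendsto_intros simp: eventually_at_filter)
  have "\<exists>\<^sub>F z in at (of_real x). d z = 0"
  proof (rule ccontr)
    assume "\<not> ?thesis"
    then have "\<forall>\<^sub>F z in at (of_real x). d z \<noteq> 0" by (simp add: frequently_def)
    then have "\<forall>\<^sub>F y in at x. d (of_real y) \<noteq> 0"
      using lim by (auto simp: filterlim_iff)
    with freq show False by (auto simp: frequently_def d_def)
  qed
  then have ev: "\<forall>\<^sub>F z in at (of_real x). d z = 0"
    by (intro not_essential_frequently_0_imp_eventually_0 isolated_singularity_at_analytic
        not_essential_analytic d)
  then have "(d \<longlongrightarrow> 0) (at (of_real x))" by (simp add: tendsto_eventually)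
  moreover have "(d \<longlongrightarrow> d (of_real x)) (at (of_real x))"
    using analytic_at_imp_isCont[OF d] by (simp add: isCont_def)
  ultimately have "d (of_real x) = 0" by (rule LIM_unique[symmetric])
  with ev show ?thesis unfolding eventually_nhds_conv_at by (auto simp: d_def)
qed

text \<open>Serves to lift a differential equation verified for real arguments to an identity of
  formal power series.\<close>

lemma has_fps_expansion_unique_real:
  fixes f g :: "complex \<Rightarrow> complex"
  assumes F: "f has_fps_expansion F" and G: "g has_fps_expansion G"
    and ev: "\<forall>\<^sub>F x::real in nhds 0. f (of_real x) = g (of_real x)"
  shows "F = G"
proof (rule eval_fps_eqD)
  have "\<exists>\<^sub>F y::real in at 0. f (of_real y) = g (of_real y)"
    using ev by (intro eventually_frequently) (auto simp: eventually_nhds_conv_at)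
  then have "\<forall>\<^sub>F z in nhds (of_real 0). f z = g z"
    using F G by (intro analytic_eq_near_real_point) (auto intro: has_fps_expansion_imp_analytic_0)
  then show "\<forall>\<^sub>F z in nhds 0. eval_fps F z = eval_fps G z"
    using F[unfolded has_fps_expansion_def, THEN conjunct2]
      G[unfolded has_fps_expansion_def, THEN conjunct2]
    unfolding of_real_0 by eventually_elim simp
qed (use F G in \<open>auto simp: has_fps_expansion_def\<close>)

text \<open>The points around which \<open>f\<close> and \<open>g\<close> agree form a set
  \<open>Z\<close> that is open and, by the identity theorem for the complex extensions, relatively
  closed in \<open>S\<close>.\<close>

lemma real_analytic_continuation:
  fixes f g :: "real \<Rightarrow> real"
  assumes S: "open S" "connected S"
    and f: "\<And>x. x \<in> S \<Longrightarrow> \<exists>h. real_extends_at h f x"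
    and g: "\<And>x. x \<in> S \<Longrightarrow> \<exists>h. real_extends_at h g x"
    and a: "a \<in> S" "\<forall>\<^sub>F x in nhds a. f x = g x"
    and x: "x \<in> S"
  shows "f x = g x"
proof -
  define Z where "Z = {x. \<forall>\<^sub>F y in nhds x. f y = g y}"
  have openZ: "open Z"
    unfolding open_subopen[of Z] unfolding Z_def eventually_nhds by blast
  have "x \<in> Z" if x: "x \<in> S" "x \<in> closure Z" for x
  proof -
    obtain h1 h2 where h: "real_extends_at h1 f x" "real_extends_at h2 g x"
      using f g x(1) by blast
    \<comment> \<open>A point of \<open>Z\<close> near \<open>x\<close> brings a whole neighbourhood
      of agreement, hence agreement at points other than \<open>x\<close>, even if that point is
      \<open>x\<close> itself.\<close>
    have "\<exists>\<^sub>F y in at x. f y = g y"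
    proof (rule ccontr)
      assume "\<not> ?thesis"
      then have "\<forall>\<^sub>F y in at x. f y \<noteq> g y" by (simp add: frequently_def)
      then obtain U where U: "open U" "x \<in> U" "\<And>y. y \<in> U \<Longrightarrow> y \<noteq> x \<Longrightarrow> f y \<noteq> g y"
        by (auto simp: eventually_at_topological)
      then obtain z where z: "z \<in> U" "z \<in> Z"
        using x(2) by (meson closure_iff_nhds_not_empty disjoint_iff subset_refl)
      have "\<forall>\<^sub>F y in nhds z. y \<in> U \<and> f y = g y"
        using z eventually_nhds_in_open[OF U(1) z(1)] by (auto simp: Z_def eventually_conj_iff)
      then have "\<forall>\<^sub>F y in nhds z. y = x" by eventually_elim (use U(3) in blast)
      then have "\<forall>\<^sub>F y in at z. False"
        using eventually_nhds_x_imp_x[of "\<lambda>y. y = x" z]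
        unfolding eventually_at_filter by (auto elim: eventually_mono)
      then show False by simp
    qed
    moreover have "\<forall>\<^sub>F y in at x. h1 (of_real y) = of_real (f y) \<and> h2 (of_real y) = of_real (g y)"
      using h by (auto simp: real_extends_at_def eventually_nhds_conv_at eventually_conj_iff)
    ultimately have "\<exists>\<^sub>F y in at x. h1 (of_real y) = h2 (of_real y)"
      by (auto elim!: frequently_rev_mp elim: eventually_mono)
    then have "\<forall>\<^sub>F z in nhds (of_real x). h1 z = h2 z"
      using h by (intro analytic_eq_near_real_point) (auto simp: real_extends_at_def)
    then have "\<forall>\<^sub>F y in nhds x. h1 (of_real y) = h2 (of_real y)"
      using tendsto_of_real[OF filterlim_ident, of x] by (auto simp: filterlim_iff)
    then have "\<forall>\<^sub>F y in nhds x. f y = g y"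
      using h[unfolded real_extends_at_def, THEN conjunct2] by eventually_elim simp
    then show ?thesis by (simp add: Z_def)
  qed
  then have "closedin (top_of_set S) (S \<inter> Z)"
    by (subst closedin_closed) (use closure_subset in \<open>auto intro!: exI[of _ "closure Z"]\<close>)
  moreover have "openin (top_of_set S) (S \<inter> Z)" using openZ by auto
  moreover have "a \<in> S \<inter> Z" using a by (simp add: Z_def)
  ultimately have "S \<inter> Z = S" using S(2) by (metis connected_clopen empty_iff)
  then have "x \<in> Z" using x by blast
  then show ?thesis by (auto simp: Z_def dest: eventually_nhds_x_imp_x)
qed

text \<open>Summation by parts with the tails \<open>r n\<close>, which tend to 0: the power series
  is \<open>r 0\<close> minus \<open>1 - t\<close> times a series in the later tails. The finitely
  many large tails are damped by \<open>1 - t\<close>; the others contribute at most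
  \<open>e / 2\<close>, since \<open>1 - t\<close> times the geometric series is 1.\<close>

lemma Abel_limit:
  fixes b :: "nat \<Rightarrow> real"
  assumes b: "summable b"
  shows "((\<lambda>t. \<Sum>k. b k * t ^ k) \<longlongrightarrow> (\<Sum>k. b k)) (at_left 1)"
proof -
  define r where "r = (\<lambda>n. \<Sum>k. b (k + n))"
  have r0: "r 0 = (\<Sum>k. b k)" by (simp add: r_def)
  have b_eq: "b n = r n - r (Suc n)" for n
    using suminf_split_head[OF summable_ignore_initial_segment[OF b, of n]] by (simp add: r_def)
  have r_lim: "r \<longlonglongrightarrow> 0"
    unfolding r_def by (rule suminf_exist_split2[OF b])
  then obtain C where C: "\<And>n. \<bar>r n\<bar> \<le> C"
    using Bseq_def convergent_imp_Bseq convergentI by (metis real_norm_def)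
  have summ: "summable (\<lambda>k. r (k + j) * t ^ k)" if "0 < t" "t < 1" for t j
  proof (rule summable_comparison_test'[where N = 0])
    show "summable (\<lambda>k. C * t ^ k)" using that by (intro summable_mult summable_geometric) auto
    show "norm (r (k + j) * t ^ k) \<le> C * t ^ k" for k
      using C[of "k + j"] that by (auto simp: abs_mult intro!: mult_right_mono)
  qed
  have eq: "(\<Sum>k. b k * t ^ k) = r 0 - (1 - t) * (\<Sum>k. r (Suc k) * t ^ k)" if t: "0 < t" "t < 1" for t
  proof -
    have "(\<Sum>k. b k * t ^ k) = (\<Sum>k. r k * t ^ k - r (Suc k) * t ^ k)"
      by (simp add: b_eq algebra_simps)
    also have "\<dots> = (\<Sum>k. r k * t ^ k) - (\<Sum>k. r (Suc k) * t ^ k)"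
      using summ[OF t, of 0] summ[OF t, of 1] by (intro suminf_diff[symmetric]) auto
    also have "(\<Sum>k. r k * t ^ k) = r 0 + (\<Sum>k. t * (r (Suc k) * t ^ k))"
      using suminf_split_head[OF summ[OF t, of 0]] by (simp add: mult_ac)
    also have "(\<Sum>k. t * (r (Suc k) * t ^ k)) = t * (\<Sum>k. r (Suc k) * t ^ k)"
      using summ[OF t, of 1] by (intro suminf_mult) auto
    finally show ?thesis by (simp add: algebra_simps)
  qed
  have "((\<lambda>t. r 0 - (1 - t) * (\<Sum>k. r (Suc k) * t ^ k)) \<longlongrightarrow> r 0) (at_left 1)"
  proof (rule tendstoI)
    fix e :: real assume e: "e > 0"
    then obtain N where N: "\<And>k. k \<ge> N \<Longrightarrow> \<bar>r k\<bar> < e / 2"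
      using r_lim[THEN LIMSEQ_D, of "e/2"] by auto
    define B where "B = (\<Sum>k<N. \<bar>r (Suc k)\<bar>)"
    have "((\<lambda>t. (1 - t) * B) \<longlongrightarrow> (1 - 1) * B) (at_left 1)"
      by (intro tendsto_intros)
    then have "\<forall>\<^sub>F t in at_left 1. (1 - t) * B < e / 2"
      using e by (intro order_tendstoD(2)[where y = "(1 - 1) * B"]) auto
    moreover have "\<forall>\<^sub>F t in at_left (1::real). t \<in> {0<..<1}"
      by (rule eventually_at_left_real) simp
    ultimately show "\<forall>\<^sub>F t in at_left 1. dist (r 0 - (1 - t) * (\<Sum>k. r (Suc k) * t ^ k)) (r 0) < e"
    proof eventually_elim
      case (elim t)
      then have t: "0 < t" "t < 1" by auto
      have geo: "(\<lambda>k. e / 2 * t ^ k) sums (e / 2 * (1 / (1 - t)))"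
        using t by (intro sums_mult geometric_sums) auto
      have fin: "(\<lambda>k. if k < N then \<bar>r (Suc k)\<bar> else 0) sums B"
        unfolding B_def using sums_If_finite_set[of "{..<N}" "\<lambda>k. \<bar>r (Suc k)\<bar>"] by simp
      have le: "\<bar>r (Suc k) * t ^ k\<bar> \<le> (if k < N then \<bar>r (Suc k)\<bar> else 0) + e / 2 * t ^ k" for k
      proof (cases "k < N")
        case True
        have "\<bar>r (Suc k)\<bar> * t ^ k \<le> \<bar>r (Suc k)\<bar> * 1"
          using t by (intro mult_left_mono power_le_one) auto
        then show ?thesis using True t e by (simp add: abs_mult add_increasing2)
      next
        case False
        then have "\<bar>r (Suc k)\<bar> \<le> e / 2" using N[of "Suc k"] by simp
        then show ?thesis using False t by (simp add: abs_mult mult_right_mono)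
      qed
      have "norm (\<Sum>k. r (Suc k) * t ^ k) \<le> B + e / 2 * (1 / (1 - t))"
      proof -
        note sums = sums_add[OF fin geo]
        have "norm (\<Sum>k. r (Suc k) * t ^ k) \<le> (\<Sum>k. (if k < N then \<bar>r (Suc k)\<bar> else 0) + e / 2 * t ^ k)"
          using le sums_summable[OF sums] by (intro norm_suminf_le) auto
        then show ?thesis using sums_unique[OF sums] by simp
      qed
      then have "(1 - t) * \<bar>\<Sum>k. r (Suc k) * t ^ k\<bar> \<le> (1 - t) * (B + e / 2 * (1 / (1 - t)))"
        using t by (intro mult_left_mono) auto
      also have "\<dots> = (1 - t) * B + e / 2" using t by (simp add: field_simps)
      also have "\<dots> < e" using elim by simp
      finally show ?case using t by (simp add: dist_norm abs_mult)
    qed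
  qed
  then show ?thesis
    unfolding r0[symmetric]
    by (rule filterlim_cong[THEN iffD1, rotated -1])
       (use eventually_at_left_real[of 0 1] eq in \<open>auto elim!: eventually_mono\<close>)
qed

text \<open>Convergence at \<open>x\<close> makes the series holomorphic on the open disc of radius
  \<open>\<bar>x\<bar>\<close>, while \<open>f\<close> has local extensions only; agreement near 0
  is therefore continued along the real interval \<open>S\<close>.\<close>

lemma real_analytic_eq_taylor_series:
  fixes f :: "real \<Rightarrow> real"
  assumes ra: "\<And>x. \<exists>h. real_extends_at h f x"
    and conv: "summable (\<lambda>k. (deriv ^^ k) f 0 / fact k * x ^ k)"
  shows "f x = (\<Sum>k. (deriv ^^ k) f 0 / fact k * x ^ k)"
proof (cases "x = 0")
  case True
  then show ?thesis
    using powser_zero[of "\<lambda>k. (deriv ^^ k) f 0 / fact k"] by simp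
next
  case False
  define a where "a = (\<lambda>k. (deriv ^^ k) f 0 / fact k)"
  define g where "g = (\<lambda>y. \<Sum>k. a k * y ^ k)"
  define H where "H = (\<lambda>z. \<Sum>k. complex_of_real (a k) * z ^ k)"
  define S where "S = ball (0::real) \<bar>x\<bar>"
  have conv': "summable (\<lambda>k. a k * x ^ k)"
    using conv by (simp add: a_def)
  then have "summable (\<lambda>k. complex_of_real (a k * x ^ k))"
    by (rule summable_of_real)
  then have cconv: "summable (\<lambda>k. complex_of_real (a k) * of_real x ^ k)"
    by simp
  have sumsH: "(\<lambda>k. complex_of_real (a k) * z ^ k) sums H z" if "norm z < \<bar>x\<bar>" for z
    unfolding H_def using powser_inside[OF cconv, of z] that by (simp add: summable_sums)
  have holH: "H holomorphic_on ball 0 \<bar>x\<bar>"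
    by (rule power_series_holomorphic) (use sumsH in auto)
  have Hg: "H (of_real y) = of_real (g y)" if "y \<in> S" for y
  proof -
    have "summable (\<lambda>k. a k * y ^ k)"
      using powser_inside[OF conv', of y] that by (simp add: S_def)
    then have "(\<lambda>k. complex_of_real (a k * y ^ k)) sums of_real (g y)"
      unfolding g_def by (intro sums_of_real summable_sums)
    then show ?thesis by (simp add: H_def sums_iff)
  qed
  have ext_g: "real_extends_at H g y" if "y \<in> S" for y
    unfolding real_extends_at_def
  proof
    show "H analytic_on {of_real y}"
      using holH that by (auto simp: analytic_at S_def intro!: exI[of _ "ball 0 \<bar>x\<bar>"])
    have "\<forall>\<^sub>F y in nhds y. y \<in> S"
      using that by (intro eventually_nhds_in_open) (auto simp: S_def)
    then show "\<forall>\<^sub>F y in nhds y. H (of_real y) = of_real (g y)"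
      by eventually_elim (rule Hg)
  qed
  obtain h where h: "real_extends_at h f 0" using ra by blast
  have "\<forall>\<^sub>F z in nhds (of_real 0). eval_fps (fps_expansion h 0) z = h z"
    using real_extends_at_fps_expansion(1)[OF h] by (simp add: has_fps_expansion_def)
  then have "\<forall>\<^sub>F z in nhds (of_real 0). H z = h z"
    by eventually_elim (simp add: H_def eval_fps_def real_extends_at_fps_expansion(2)[OF h] a_def)
  then have "\<forall>\<^sub>F y in nhds 0. H (of_real y) = h (of_real y)"
    using tendsto_of_real[OF filterlim_ident, of 0] by (auto simp: filterlim_iff)
  moreover have "\<forall>\<^sub>F y in nhds 0. h (of_real y) = of_real (f y)"
    using h by (simp add: real_extends_at_def)
  moreover have "\<forall>\<^sub>F y in nhds 0. H (of_real y) = of_real (g y)"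
    using ext_g[of 0] False by (simp add: S_def real_extends_at_def)
  ultimately have "\<forall>\<^sub>F y in nhds 0. f y = g y"
    by eventually_elim simp
  then have fg: "f y = g y" if "y \<in> S" for y
    using real_analytic_continuation[of S f g 0 y] ra ext_g that False by (auto simp: S_def)
  \<comment> \<open>The point \<open>x\<close> may lie on the circle of convergence, so both sides
    are compared along \<open>t * x\<close> as \<open>t\<close> tends to 1 from below.\<close>
  have "isCont f x"
    using real_extends_at_deriv(1) ra field_differentiable_imp_continuous_at by blast
  then have lim: "((\<lambda>t. f (t * x)) \<longlongrightarrow> f (1 * x)) (at_left 1)"
    by (intro isCont_tendsto_compose[of _ f] tendsto_intros) simp
  have "((\<lambda>t. \<Sum>k. (a k * x ^ k) * t ^ k) \<longlongrightarrow> f x) (at_left 1)"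
  proof (rule Lim_transform_eventually[rotated])
    show "((\<lambda>t. f (t * x)) \<longlongrightarrow> f x) (at_left 1)"
      using lim by simp
    have "\<forall>\<^sub>F t in at_left (1::real). t \<in> {0<..<1}"
      by (rule eventually_at_left_real) simp
    then show "\<forall>\<^sub>F t in at_left 1. f (t * x) = (\<Sum>k. (a k * x ^ k) * t ^ k)"
    proof eventually_elim
      case (elim t)
      then have "t * x \<in> S" using False by (auto simp: S_def abs_mult)
      then show ?case by (simp add: fg g_def power_mult_distrib mult_ac)
    qed
  qed
  moreover have "((\<lambda>t. \<Sum>k. (a k * x ^ k) * t ^ k) \<longlongrightarrow> (\<Sum>k. a k * x ^ k)) (at_left 1)"
    by (rule Abel_limit) (rule conv')
  ultimately show ?thesis
    unfolding a_def by (rule tendsto_unique[rotated]) simp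
qed

section \<open>The standard normal distribution and the call price\<close>

interpretation std_normal: real_distribution std_normal_distribution
  by (rule real_dist_normal_dist)

lemma entire_primitive:
  assumes "f holomorphic_on UNIV"
  obtains F :: "complex \<Rightarrow> complex" where "\<And>z. (F has_field_derivative f z) (at z)" "F 0 = a"
proof -
  obtain G where G: "\<And>z. (G has_field_derivative f z) (at z)"
    using holomorphic_convex_primitive'[OF convex_UNIV open_UNIV assms] by auto
  show ?thesis
    by (rule that[of "\<lambda>z. G z - G 0 + a"]) (auto intro!: derivative_eq_intros G)
qed

lemma Phi_has_real_derivative:
  "(Phi has_real_derivative std_normal_density x) (at x)"
proof -
  have cont: "continuous_on A std_normal_density" for A
    unfolding std_normal_density_def by (intro continuous_intros) auto
  have diff: "Phi b - Phi a = integral {a..b} std_normal_density" if "a < b" for a b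
  proof -
    have "Phi b - Phi a = measure std_normal_distribution {a<..b}"
      using std_normal.cdf_diff_eq[OF that] by simp
    also have "\<dots> = (LINT x|std_normal_distribution. indicator {a<..b} x)"
      by (simp add: Bochner_Integration.integral_indicator space_density)
    also have "\<dots> = (LINT x|lborel. std_normal_density x * indicator {a<..b} x)"
      by (rule integral_real_density) auto
    also have "\<dots> = (LINT x:{a..b}|lborel. std_normal_density x)"
      unfolding set_lebesgue_integral_def
    proof (rule integral_cong_AE)
      show "AE x in lborel. std_normal_density x * indicator {a<..b} x
          = indicator {a..b} x *\<^sub>R std_normal_density x"
        using AE_lborel_singleton[of a] by eventually_elim (simp add: indicator_def)
    qed auto
    also have "\<dots> = integral {a..b} std_normal_density"
      by (rule set_borel_integral_eq_integral)
         (rule borel_integrable_atLeastAtMost'[OF cont])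
    finally show ?thesis .
  qed
  \<comment> \<open>The base point \<open>x - 1\<close> keeps the integral on a compact interval
    around \<open>x\<close>; the constant \<open>Phi (x - 1)\<close> then restores the distribution
    function.\<close>
  have "((\<lambda>y. integral {x - 1..y} std_normal_density) has_real_derivative std_normal_density x)
      (at x within {x - 1..x + 1})"
    by (rule integral_has_real_derivative[OF cont]) simp
  then have "((\<lambda>y. integral {x - 1..y} std_normal_density) has_real_derivative std_normal_density x) (at x)"
    by (simp add: at_within_Icc_at)
  then have "((\<lambda>y. Phi (x - 1) + integral {x - 1..y} std_normal_density) has_real_derivative
      0 + std_normal_density x) (at x)"
    by (intro DERIV_add DERIV_const)
  moreover have "\<forall>\<^sub>F y in nhds x. Phi (x - 1) + integral {x - 1..y} std_normal_density = Phi y"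
    using eventually_nhds_in_open[of "{x - 1<..}" x]
    by (auto elim!: eventually_mono simp: diff[symmetric])
  ultimately show ?thesis
    by (subst DERIV_cong_ev[OF refl _ refl, where g = "\<lambda>y. Phi (x - 1) + integral {x - 1..y} std_normal_density"])
       (auto simp: eq_commute)
qed

lemma isCont_Phi: "isCont Phi x"
  using Phi_has_real_derivative by (rule DERIV_isCont)

lemma std_normal_density_even: "std_normal_density (- x) = std_normal_density x"
  by (simp add: std_normal_density_def)

lemma std_normal_density_pos: "std_normal_density x > 0"
  by (simp add: normal_density_pos)

text \<open>Since the density is even, \<open>Phi x + Phi (- x)\<close> has derivative 0; its limit
  at infinity is 1.\<close>

lemma Phi_minus: "Phi (- x) = 1 - Phi x"
proof -
  define h where "h = (\<lambda>x. Phi x + Phi (- x))"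
  have "(h has_real_derivative 0) (at x)" for x
    unfolding h_def
    by (auto intro!: derivative_eq_intros DERIV_chain2[OF Phi_has_real_derivative]
        Phi_has_real_derivative simp: std_normal_density_even)
  then have const: "h x = h y" for x y
    by (rule DERIV_isconst_all[rule_format])
  have "(h \<longlongrightarrow> 1 + 0) at_top"
    unfolding h_def
    by (intro tendsto_add std_normal.cdf_lim_at_top_prob
        filterlim_compose[OF std_normal.cdf_lim_at_bot filterlim_uminus_at_bot_at_top])
  moreover have "(h \<longlongrightarrow> h x) at_top"
    using const[of _ x] by (simp add: tendsto_eventually)
  ultimately have "h x = 1"
    using tendsto_unique[OF trivial_limit_at_top_linorder, of h "1 + 0" "h x"] by simp
  then show ?thesis by (simp add: h_def)
qed

lemma Phi_zero: "Phi 0 = 1 / 2"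
  using Phi_minus[of 0] by simp

lemma strict_mono_Phi: "strict_mono Phi"
proof (rule strict_monoI)
  fix x y :: real assume "x < y"
  then show "Phi x < Phi y"
    by (rule DERIV_pos_imp_increasing) (use Phi_has_real_derivative std_normal_density_pos in blast)
qed

text \<open>The Gaussian density is entire and so has an entire primitive; the value 1/2 prescribed
  at 0 is \<open>Phi 0\<close>, and equal derivatives along the real axis do the rest.\<close>

lemma Phi_complex_extension:
  obtains Q :: "complex \<Rightarrow> complex"
  where "\<And>z. (Q has_field_derivative exp (- z\<^sup>2 / 2) / of_real (sqrt (2 * pi))) (at z)"
    and "\<And>x. Q (of_real x) = of_real (Phi x)"
proof -
  have "(\<lambda>z. exp (- z\<^sup>2 / 2) / of_real (sqrt (2 * pi))) holomorphic_on UNIV"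
    by (intro holomorphic_intros) auto
  then obtain Q :: "complex \<Rightarrow> complex"
    where Q: "\<And>z. (Q has_field_derivative exp (- z\<^sup>2 / 2) / of_real (sqrt (2 * pi))) (at z)"
    and Q0: "Q 0 = 1 / 2"
    by (rule entire_primitive[where a = "1 / 2"]) blast
  have dens: "exp (- (of_real x)\<^sup>2 / 2) / of_real (sqrt (2 * pi)) = complex_of_real (std_normal_density x)" for x
    by (simp add: std_normal_density_def flip: exp_of_real)
  have "((\<lambda>x. Q (of_real x) - of_real (Phi x)) has_vector_derivative 0) (at x)" for x
    using has_vector_derivative_diff[OF has_vector_derivative_real_field[OF Q]
        has_vector_derivative_of_real[OF Phi_has_real_derivative]] dens
    by simp
  then have "(\<lambda>x. Q (of_real x) - of_real (Phi x)) x = (\<lambda>x. Q (of_real x) - of_real (Phi x)) 0" for x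
    by (intro has_derivative_zero_unique[of UNIV])
       (auto simp: has_vector_derivative_def intro: has_derivative_at_withinI)
  then have "Q (of_real x) = of_real (Phi x)" for x
    using Q0 Phi_zero by simp
  with Q show ?thesis using that by blast
qed

text \<open>The Black-Scholes call in units of the spot: \<open>m\<close> is the log of spot over
  discounted strike, \<open>s\<close> the total volatility, and the arguments of \<open>Phi\<close>
  are d_1 and d_2. Rate and maturity are absorbed in \<open>m\<close> and \<open>s\<close>.\<close>

definition call_price :: "real \<Rightarrow> real \<Rightarrow> real"
  where "call_price m s = Phi (m / s + s / 2) - exp (- m) * Phi (m / s - s / 2)"

text \<open>The squares of d_1 and d_2 differ by \<open>2 * m\<close>. This makes the inner
  derivatives cancel in all sensitivities below.\<close>

lemma std_normal_density_shift:
  assumes "s \<noteq> 0"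
  shows "exp (- m) * std_normal_density (m / s - s / 2) = std_normal_density (m / s + s / 2)"
proof -
  have "- m - (m / s - s / 2)\<^sup>2 / 2 = - (m / s + s / 2)\<^sup>2 / 2"
    using assms by (simp add: power2_eq_square field_simps)
  then show ?thesis
    by (simp add: std_normal_density_def flip: exp_add)
qed

lemma call_price_has_vega:
  assumes "s > 0"
  shows "(call_price m has_real_derivative std_normal_density (m / s + s / 2)) (at s)"
proof -
  have "(call_price m has_real_derivative
      std_normal_density (m / s + s / 2) * (- m / s\<^sup>2 + 1 / 2)
      - exp (- m) * (std_normal_density (m / s - s / 2) * (- m / s\<^sup>2 - 1 / 2))) (at s)"
    unfolding call_price_def using assms
    by (auto intro!: derivative_eq_intros DERIV_chain2[OF Phi_has_real_derivative]
        simp: power2_eq_square)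
  also have "exp (- m) * (std_normal_density (m / s - s / 2) * (- m / s\<^sup>2 - 1 / 2)) =
      std_normal_density (m / s + s / 2) * (- m / s\<^sup>2 - 1 / 2)"
    using std_normal_density_shift[of s m] assms by (simp flip: mult.assoc)
  finally show ?thesis by (simp add: algebra_simps)
qed

text \<open>Here \<open>m\<close> moves the discounted strike at fixed spot, so the derivative
  carries d_2 and the factor \<open>exp (- m)\<close>, unlike the usual delta in the spot.\<close>

lemma call_price_has_delta:
  assumes "s > 0"
  shows "((\<lambda>m. call_price m s) has_real_derivative exp (- m) * Phi (m / s - s / 2)) (at m)"
proof -
  have "((\<lambda>m. call_price m s) has_real_derivative
      std_normal_density (m / s + s / 2) / s
      - (exp (- m) * (std_normal_density (m / s - s / 2) / s) - exp (- m) * Phi (m / s - s / 2))) (at m)"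
    unfolding call_price_def using assms
    by (auto intro!: derivative_eq_intros DERIV_chain2[OF Phi_has_real_derivative])
  also have "exp (- m) * (std_normal_density (m / s - s / 2) / s) = std_normal_density (m / s + s / 2) / s"
    using std_normal_density_shift[of s m] assms by (simp only: times_divide_eq_right)
  finally show ?thesis by simp
qed

lemma call_price_less_iff:
  assumes "s > 0" "t > 0"
  shows "call_price m s < call_price m t \<longleftrightarrow> s < t"
proof -
  have "call_price m s < call_price m t" if "s < t" "s > 0" for s t
  proof (rule DERIV_pos_imp_increasing[OF that(1)])
    fix x assume "s \<le> x"
    then have "x > 0" using that(2) by simp
    then show "\<exists>y. (call_price m has_real_derivative y) (at x) \<and> y > 0"
      using call_price_has_vega std_normal_density_pos by blast
  qed
  then show ?thesis using assms by (metis less_asym linorder_less_linear)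
qed

text \<open>Put-call symmetry: changing the sign of \<open>m\<close> turns (d_1, d_2) into (-d_2,
  -d_1). The price undergoes an affine map free of \<open>s\<close>, which is compatible with
  mixtures of total weight 1; hence the evenness of the mixture volatility.\<close>

lemma call_price_minus:
  "call_price (- m) s = 1 - exp m + exp m * call_price m s"
proof -
  have "Phi (- m / s + s / 2) = 1 - Phi (m / s - s / 2)" "Phi (- m / s - s / 2) = 1 - Phi (m / s + s / 2)"
    using Phi_minus[of "m / s - s / 2"] Phi_minus[of "m / s + s / 2"] by (simp_all add: algebra_simps)
  moreover have "exp m * (exp (- m) * Phi (m / s - s / 2)) = Phi (m / s - s / 2)"
    by (simp flip: mult.assoc exp_add)
  ultimately show ?thesis
    unfolding call_price_def by (simp add: right_diff_distrib)
qed

text \<open>Needed to rule out volatility 0 as implied volatility of a mixture. For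
  \<open>m \<ge> 0\<close> the bound is the limit as the volatility tends to 0, approached from
  above by monotonicity; for negative \<open>m\<close> symmetry turns it into positivity of the
  price.\<close>

lemma call_price_greater_intrinsic:
  assumes s: "s > 0"
  shows "call_price m s > max (1 - exp (- m)) 0"
proof -
  have *: "call_price m s > 1 - exp (- m)" if m: "m \<ge> 0" for m
  proof -
    have lim: "(call_price m \<longlongrightarrow> 1 - exp (- m)) (at_right 0)"
    proof (cases "m = 0")
      case True
      have "((\<lambda>s. Phi (s / 2) - Phi (- s / 2)) \<longlongrightarrow> Phi (0 / 2) - Phi (- 0 / 2)) (at_right 0)"
        by (rule tendsto_diff; rule isCont_tendsto_compose[OF isCont_Phi]; (intro tendsto_intros; simp))
      then show ?thesis using True by (simp add: call_price_def[abs_def])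
    next
      case False
      then have "m > 0" using m by simp
      then have "filterlim (\<lambda>s. m / s + s / 2) at_top (at_right 0)"
        "filterlim (\<lambda>s. m / s - s / 2) at_top (at_right 0)"
        by real_asymp+
      then have "(call_price m \<longlongrightarrow> 1 - exp (- m) * 1) (at_right 0)"
        unfolding call_price_def
        by (intro tendsto_intros filterlim_compose[OF std_normal.cdf_lim_at_top_prob])
      then show ?thesis by simp
    qed
    \<comment> \<open>A limit yields a weak inequality only; stopping at \<open>s / 2\<close> leaves
      room for a strict one at \<open>s\<close>.\<close>
    have "1 - exp (- m) \<le> call_price m (s / 2)"
    proof (rule tendsto_upperbound[OF lim])
      have "\<forall>\<^sub>F t in at_right 0. t \<in> {0<..<s / 2}"
        using s by (intro eventually_at_right_real) auto
      then show "\<forall>\<^sub>F t in at_right 0. call_price m t \<le> call_price m (s / 2)"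
        by eventually_elim (use s in \<open>auto simp: less_imp_le call_price_less_iff\<close>)
    qed simp
    also have "\<dots> < call_price m s" using s by (simp add: call_price_less_iff)
    finally show ?thesis .
  qed
  show ?thesis
  proof (cases "m \<ge> 0")
    case True
    then show ?thesis using *[of m] by simp
  next
    case False
    then have "call_price m s > 1 - exp (- m) + exp (- m) * (1 - exp m)"
      using *[of "- m"] call_price_minus[of "- m" s] by simp
    also have "1 - exp (- m) + exp (- m) * (1 - exp m) = 0"
      by (simp add: right_diff_distrib flip: exp_add)
    finally show ?thesis using False by simp
  qed
qed

section \<open>Total volatility of a mixture of call prices\<close>

locale vol_mixture =
  fixes I :: "'i set" and w v :: "'i \<Rightarrow> real"
  assumes fin: "finite I"
    and w_nonneg: "\<And>i. i \<in> I \<Longrightarrow> w i \<ge> 0"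
    and w_sum: "sum w I = 1"
    and v_pos: "\<And>i. i \<in> I \<Longrightarrow> v i > 0"
begin

definition mixture_price :: "real \<Rightarrow> real"
  where "mixture_price m = (\<Sum>i\<in>I. w i * call_price m (v i))"

definition mixture_vol :: "real \<Rightarrow> real"
  where "mixture_vol m = (THE s. s > 0 \<and> call_price m s = mixture_price m)"

lemma v_nz: "i \<in> I \<Longrightarrow> v i \<noteq> 0"
  using v_pos by force

text \<open>The mixture lies between the prices at the smallest and the largest \<open>v i\<close>,
  so the intermediate value theorem applies; positive vega gives uniqueness.\<close>

lemma mixture_vol_ex1: "\<exists>!s. s > 0 \<and> call_price m s = mixture_price m"
proof -
  have ne: "I \<noteq> {}" using w_sum by auto
  define l u where "l = Min (v ` I)" and "u = Max (v ` I)"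
  have l: "l > 0" and bounds: "\<And>i. i \<in> I \<Longrightarrow> l \<le> v i \<and> v i \<le> u"
    using fin ne v_pos by (auto simp: l_def u_def)
  have lu: "l \<le> u" using bounds ne by force
  have mono: "call_price m s \<le> call_price m t" if "0 < s" "s \<le> t" for s t
    using that call_price_less_iff[of t s m] by (simp add: linorder_not_less[symmetric])
  have "call_price m l = (\<Sum>i\<in>I. w i * call_price m l)"
    using w_sum by (simp flip: sum_distrib_right)
  also have "\<dots> \<le> mixture_price m"
    unfolding mixture_price_def using l bounds w_nonneg
    by (intro sum_mono mult_left_mono mono) auto
  finally have lower: "call_price m l \<le> mixture_price m" .
  have "mixture_price m \<le> (\<Sum>i\<in>I. w i * call_price m u)"
    unfolding mixture_price_def using v_pos bounds w_nonneg
    by (intro sum_mono mult_left_mono mono) auto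
  also have "\<dots> = call_price m u"
    using w_sum by (simp flip: sum_distrib_right)
  finally have upper: "mixture_price m \<le> call_price m u" .
  have "isCont (call_price m) x" if "l \<le> x" for x
    using that l by (intro DERIV_isCont[OF call_price_has_vega]) simp
  then obtain s where "l \<le> s" "call_price m s = mixture_price m"
    using IVT[OF lower upper lu] by blast
  moreover have "s = t" if "s > 0" "t > 0" "call_price m s = call_price m t" for s t
    using that call_price_less_iff[of s t m] call_price_less_iff[of t s m] by force
  ultimately show ?thesis using l by (metis less_le_trans)
qed

lemma mixture_vol_pos: "mixture_vol m > 0"
  and call_price_mixture_vol: "call_price m (mixture_vol m) = mixture_price m"
  using theI'[OF mixture_vol_ex1[of m]] by (simp_all add: mixture_vol_def)

lemma mixture_vol_eqI: "s > 0 \<Longrightarrow> call_price m s = mixture_price m \<Longrightarrow> mixture_vol m = s"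
  using mixture_vol_ex1 mixture_vol_pos call_price_mixture_vol by blast

lemma mixture_vol_minus: "mixture_vol (- m) = mixture_vol m"
proof (rule mixture_vol_eqI[OF mixture_vol_pos])
  have "mixture_price (- m) = (\<Sum>i\<in>I. w i * (1 - exp m) + exp m * (w i * call_price m (v i)))"
    unfolding mixture_price_def by (intro sum.cong) (auto simp: call_price_minus algebra_simps)
  also have "\<dots> = 1 - exp m + exp m * mixture_price m"
    using w_sum by (simp add: sum.distrib mixture_price_def flip: sum_distrib_right sum_distrib_left)
  finally show "call_price (- m) (mixture_vol m) = mixture_price (- m)"
    by (simp add: call_price_minus call_price_mixture_vol)
qed

text \<open>At \<open>m = 0\<close> the price is an affine function of \<open>Phi (s / 2)\<close>,
  and affine functions commute with averages of total weight 1.\<close>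

lemma Phi_mixture_vol_0: "Phi (mixture_vol 0 / 2) = (\<Sum>i\<in>I. w i * Phi (v i / 2))"
proof -
  have c0: "call_price 0 s = 2 * Phi (s / 2) - 1" for s
    using Phi_minus[of "s / 2"] by (simp add: call_price_def)
  have "2 * Phi (mixture_vol 0 / 2) - 1 = (\<Sum>i\<in>I. w i * (2 * Phi (v i / 2) - 1))"
    using call_price_mixture_vol[of 0] unfolding mixture_price_def c0 .
  also have "\<dots> = (\<Sum>i\<in>I. 2 * (w i * Phi (v i / 2)) - w i)"
    by (simp add: algebra_simps)
  also have "\<dots> = 2 * (\<Sum>i\<in>I. w i * Phi (v i / 2)) - 1"
    using w_sum by (simp add: sum_subtractf sum_distrib_left)
  finally show ?thesis by simp
qed

text \<open>Comparing \<open>mixture_vol x\<close> with a fixed \<open>a > 0\<close> amounts to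
  comparing two prices that are continuous in \<open>x\<close>. Continuity is later what selects the
  right root of the complexified equation.\<close>

lemma isCont_mixture_vol: "isCont mixture_vol m"
  unfolding isCont_def
proof (rule order_tendstoI)
  have isCont: "isCont (\<lambda>m. call_price m s - mixture_price m) x" if "s > 0" for s x
    unfolding mixture_price_def using that v_pos
    by (intro continuous_intros DERIV_isCont[OF call_price_has_delta]) auto
  have sign: "call_price x s < mixture_price x \<longleftrightarrow> s < mixture_vol x"
    "call_price x s > mixture_price x \<longleftrightarrow> s > mixture_vol x" if "s > 0" for s x
    using call_price_less_iff[OF that mixture_vol_pos, of x x]
      call_price_less_iff[OF mixture_vol_pos that, of x x]
    by (simp_all add: call_price_mixture_vol)
  fix a
  show "\<forall>\<^sub>F x in at m. a < mixture_vol x" if a: "a < mixture_vol m"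
  proof (cases "a > 0")
    case True
    have "\<forall>\<^sub>F x in at m. call_price x a - mixture_price x < 0"
      using isCont[OF True, of m] sign[OF True, of m] a
      unfolding isCont_def by (intro order_tendstoD(2)) auto
    then show ?thesis by eventually_elim (use sign[OF True] in simp)
  next
    case False
    then show ?thesis
      by (intro always_eventually allI) (meson mixture_vol_pos less_le_trans not_le order.strict_trans1)
  qed
  show "\<forall>\<^sub>F x in at m. mixture_vol x < a" if a: "mixture_vol m < a"
  proof -
    have "a > 0" using a mixture_vol_pos[of m] by simp
    have "\<forall>\<^sub>F x in at m. call_price x a - mixture_price x > 0"
      using isCont[OF \<open>a > 0\<close>, of m] sign[OF \<open>a > 0\<close>, of m] a
      unfolding isCont_def by (intro order_tendstoD(1)) auto
    then show ?thesis by eventually_elim (use sign[OF \<open>a > 0\<close>] in simp)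
  qed
qed

lemma mixture_vol_real_extends: "\<exists>h. real_extends_at h mixture_vol m"
proof -
  obtain Q :: "complex \<Rightarrow> complex"
    where Q': "\<And>z. (Q has_field_derivative exp (- z\<^sup>2 / 2) / of_real (sqrt (2 * pi))) (at z)"
    and Q: "\<And>x. Q (of_real x) = of_real (Phi x)"
    by (rule Phi_complex_extension) blast
  define q where "q = (\<lambda>z::complex. exp (- z\<^sup>2 / 2) / of_real (sqrt (2 * pi)))"
  define c where "c = (\<lambda>z y. Q (z / y + y / 2) - exp (- z) * Q (z / y - y / 2))"
  define F where "F = (\<lambda>z y. c z y - (\<Sum>i\<in>I. of_real (w i) * c z (of_real (v i))))"
  define F' where "F' = (\<lambda>z y. q (z / y + y / 2))"
  \<comment> \<open>The right half-plane is an open set that contains the positive volatilities and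
    avoids the pole of \<open>z / y\<close>.\<close>
  define W where "W = {x :: complex \<times> complex. Re (snd x) > 0}"
  have Qhol: "Q holomorphic_on A" for A
    using Q' by (meson field_differentiable_at_within field_differentiable_def holomorphic_onI)
  have Qcomp: "(\<lambda>z. Q (f z)) holomorphic_on A" if "f holomorphic_on A" for f A
    using holomorphic_on_compose[OF that Qhol] by (simp add: o_def)
  have c_hol: "(\<lambda>z. c z (y z)) holomorphic_on A"
    if "y holomorphic_on A" "\<And>z. z \<in> A \<Longrightarrow> y z \<noteq> 0" for y A
    unfolding c_def using that by (intro holomorphic_intros Qcomp) auto
  have c_real: "c (of_real x) (of_real y) = of_real (call_price x y)" for x y
  proof -
    have "Q (of_real x / of_real y + of_real y / 2) = of_real (Phi (x / y + y / 2))"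
      "Q (of_real x / of_real y - of_real y / 2) = of_real (Phi (x / y - y / 2))"
      using Q[of "x / y + y / 2"] Q[of "x / y - y / 2"] by simp_all
    then show ?thesis by (simp add: c_def call_price_def flip: exp_of_real)
  qed
  have F_real: "F (of_real x) (of_real y) = of_real (call_price x y - mixture_price x)" for x y
    by (simp add: F_def c_real mixture_price_def)
  have W: "open W"
    unfolding W_def by (intro open_Collect_less continuous_intros)
  have W0: "(of_real m, of_real (mixture_vol m)) \<in> W"
    by (simp add: W_def mixture_vol_pos)
  have nz: "y \<noteq> 0" if "(z, y) \<in> W" for z y :: complex
    using that by (auto simp: W_def)
  have F_hol: "(\<lambda>z. F z (y z)) holomorphic_on A"
    if "open A" "y holomorphic_on A" "\<And>z. z \<in> A \<Longrightarrow> (z, y z) \<in> W" for y A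
  proof -
    have 1: "(\<lambda>z. c z (y z)) holomorphic_on A"
      using nz that(3) by (intro c_hol[OF that(2)]) blast
    have 2: "(\<lambda>z. c z (of_real (v i))) holomorphic_on A" if "i \<in> I" for i
      using v_nz[OF that] by (intro c_hol holomorphic_on_const) simp
    show ?thesis
      unfolding F_def
      by (intro holomorphic_on_diff holomorphic_on_sum holomorphic_on_mult holomorphic_on_const 1 2)
  qed
  have F_der: "(F z has_field_derivative F' z y) (at y)" if "(z, y) \<in> W" for z y
  proof -
    have y: "y \<noteq> 0" using nz[OF that] .
    have shift: "exp (- z) * q (z / y - y / 2) = q (z / y + y / 2)"
    proof -
      have "- z - (z / y - y / 2)\<^sup>2 / 2 = - (z / y + y / 2)\<^sup>2 / 2"
        using y by (simp add: power2_eq_square field_simps)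
      then show ?thesis by (simp add: q_def flip: exp_add)
    qed
    have d1: "((\<lambda>y. z / y + y / 2) has_field_derivative - z / y\<^sup>2 + 1 / 2) (at y)"
      and d2: "((\<lambda>y. z / y - y / 2) has_field_derivative - z / y\<^sup>2 - 1 / 2) (at y)"
      using y by (auto intro!: derivative_eq_intros simp: power2_eq_square)
    have "(c z has_field_derivative q (z / y + y / 2) * (- z / y\<^sup>2 + 1 / 2)
        - exp (- z) * (q (z / y - y / 2) * (- z / y\<^sup>2 - 1 / 2))) (at y)"
      unfolding c_def q_def by (intro DERIV_diff DERIV_cmult DERIV_chain2[OF Q' d1] DERIV_chain2[OF Q' d2])
    also have "exp (- z) * (q (z / y - y / 2) * (- z / y\<^sup>2 - 1 / 2)) =
        q (z / y + y / 2) * (- z / y\<^sup>2 - 1 / 2)"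
      using shift by (simp flip: mult.assoc)
    finally have "(c z has_field_derivative F' z y) (at y)"
      by (simp add: F'_def algebra_simps)
    then have "((\<lambda>y. F z y) has_field_derivative F' z y - 0) (at y)"
      unfolding F_def by (intro DERIV_diff DERIV_const)
    then show ?thesis by simp
  qed
  have F'_cont: "continuous_on W (\<lambda>(z, y). F' z y)"
    unfolding F'_def q_def case_prod_unfold
    by (intro continuous_intros) (auto simp: W_def)
  have F0: "F (of_real m) (of_real (mixture_vol m)) = 0"
    by (simp add: F_real call_price_mixture_vol)
  \<comment> \<open>The derivative is an exponential up to a constant, so no real \<open>m\<close>
    is exceptional.\<close>
  have F'0: "F' (of_real m) (of_real (mixture_vol m)) \<noteq> 0"
    by (simp add: F'_def q_def)
  have "\<exists>\<delta>>0. \<exists>\<epsilon>>0. \<exists>h. h holomorphic_on ball (of_real m) \<delta> \<and>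
      (\<forall>z\<in>ball (of_real m) \<delta>. \<forall>y\<in>cball (of_real (mixture_vol m)) \<epsilon>. F z y = 0 \<longleftrightarrow> y = h z)"
    by (rule holomorphic_implicit_function[where F = F and F' = F', OF W W0 _ _ F'_cont F0 F'0])
       (fact F_hol, fact F_der, blast)
  then obtain h \<delta> \<epsilon> where \<delta>: "\<delta> > 0" and \<epsilon>: "\<epsilon> > 0" and h: "h holomorphic_on ball (of_real m) \<delta>"
    and iff: "\<forall>z\<in>ball (of_real m) \<delta>. \<forall>y\<in>cball (of_real (mixture_vol m)) \<epsilon>. F z y = 0 \<longleftrightarrow> y = h z"
    by blast
  have "real_extends_at h mixture_vol m"
    unfolding real_extends_at_def
  proof
    show "h analytic_on {of_real m}"
      using h \<delta> by (auto simp: analytic_at intro!: exI[of _ "ball (of_real m) \<delta>"])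
    have "\<forall>\<^sub>F x in nhds m. x \<in> ball m \<delta>"
      using \<delta> by (intro eventually_nhds_in_open) auto
    \<comment> \<open>Continuity puts \<open>mixture_vol x\<close> into the disc on which the root
      is unique, which forces it to equal \<open>h\<close> there.\<close>
    moreover have "\<forall>\<^sub>F x in nhds m. dist (mixture_vol x) (mixture_vol m) < \<epsilon>"
      using isCont_mixture_vol[of m] \<epsilon>
      by (auto simp: isCont_def tendsto_iff eventually_nhds_conv_at)
    ultimately show "\<forall>\<^sub>F x in nhds m. h (of_real x) = of_real (mixture_vol x)"
    proof eventually_elim
      case (elim x)
      then have "complex_of_real x \<in> ball (of_real m) \<delta>"
        "complex_of_real (mixture_vol x) \<in> cball (of_real (mixture_vol m)) \<epsilon>"
        by (auto simp: dist_commute)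
      then show ?case
        using iff F_real[of x "mixture_vol x"] call_price_mixture_vol[of x] by (simp del: mem_ball mem_cball)
    qed
  qed
  then show ?thesis by blast
qed

lemma mixture_vol_smooth: "(deriv ^^ k) mixture_vol field_differentiable at m"
  using mixture_vol_real_extends[of m] real_extends_at_higher_deriv real_extends_at_deriv(1) by blast

lemma mixture_vol_has_deriv:
  "((deriv ^^ k) mixture_vol has_real_derivative (deriv ^^ Suc k) mixture_vol m) (at m)"
  using mixture_vol_smooth[of k m] by (simp add: DERIV_deriv_iff_field_differentiable)

lemma mixture_vol_odd_deriv_0:
  assumes "odd k"
  shows "(deriv ^^ k) mixture_vol 0 = 0"
proof -
  have "(deriv ^^ k) mixture_vol (- x) = (- 1) ^ k * (deriv ^^ k) mixture_vol x" for x k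
  proof (induction k arbitrary: x)
    case 0
    show ?case by (simp add: mixture_vol_minus)
  next
    case (Suc k)
    have "((\<lambda>y. (deriv ^^ k) mixture_vol (- y)) has_real_derivative
        (deriv ^^ Suc k) mixture_vol (- x) * (- 1)) (at x)"
      by (rule DERIV_chain2[OF mixture_vol_has_deriv]) (auto intro!: derivative_eq_intros)
    moreover have "((\<lambda>y. (deriv ^^ k) mixture_vol (- y)) has_real_derivative
        (- 1) ^ k * (deriv ^^ Suc k) mixture_vol x) (at x)"
      unfolding Suc by (rule DERIV_cmult[OF mixture_vol_has_deriv])
    ultimately show ?case
      using DERIV_unique by fastforce
  qed
  from this[of k 0] assms show ?thesis by simp
qed

lemma mixture_vol_first_order:
  fixes m :: real
  defines "s \<equiv> mixture_vol m"
  shows "Phi (m / s - s / 2) + std_normal_density (m / s - s / 2) * deriv mixture_vol m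
    = (\<Sum>i\<in>I. w i * Phi (m / v i - v i / 2))"
proof -
  have s: "s > 0" by (simp add: s_def mixture_vol_pos)
  define s1 where "s1 = deriv mixture_vol m"
  have ds: "(mixture_vol has_real_derivative s1) (at m)"
    using mixture_vol_has_deriv[of 0 m] by (simp add: s1_def)
  have "((\<lambda>m. call_price m (mixture_vol m)) has_real_derivative
      std_normal_density (m / s + s / 2) * ((s - m * s1) / s\<^sup>2 + s1 / 2)
      - (exp (- m) * (std_normal_density (m / s - s / 2) * ((s - m * s1) / s\<^sup>2 - s1 / 2))
         - exp (- m) * Phi (m / s - s / 2))) (at m)"
    unfolding call_price_def
    by (rule derivative_eq_intros DERIV_chain2[OF Phi_has_real_derivative] ds refl
        | (use s in \<open>simp add: s_def power2_eq_square\<close>))+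
  \<comment> \<open>After this shift both terms carry the density at d_1, and the inner derivatives
    of d_1 and d_2 differ by exactly \<open>s1\<close>.\<close>
  also have "exp (- m) * (std_normal_density (m / s - s / 2) * ((s - m * s1) / s\<^sup>2 - s1 / 2)) =
      std_normal_density (m / s + s / 2) * ((s - m * s1) / s\<^sup>2 - s1 / 2)"
    using std_normal_density_shift[of s m] s by (simp flip: mult.assoc)
  finally have "((\<lambda>m. call_price m (mixture_vol m)) has_real_derivative
      std_normal_density (m / s + s / 2) * s1 + exp (- m) * Phi (m / s - s / 2)) (at m)"
    by (simp add: algebra_simps)
  moreover have "(mixture_price has_real_derivative
      (\<Sum>i\<in>I. w i * (exp (- m) * Phi (m / v i - v i / 2)))) (at m)"
    unfolding mixture_price_def
    by (intro DERIV_sum DERIV_cmult call_price_has_delta v_pos)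
  ultimately have "std_normal_density (m / s + s / 2) * s1 + exp (- m) * Phi (m / s - s / 2)
      = (\<Sum>i\<in>I. w i * (exp (- m) * Phi (m / v i - v i / 2)))"
    unfolding call_price_mixture_vol by (rule DERIV_unique)
  also have "\<dots> = exp (- m) * (\<Sum>i\<in>I. w i * Phi (m / v i - v i / 2))"
    by (simp add: sum_distrib_left mult_ac)
  finally have "exp (- m) * (Phi (m / s - s / 2) + std_normal_density (m / s - s / 2) * s1)
      = exp (- m) * (\<Sum>i\<in>I. w i * Phi (m / v i - v i / 2))"
    using std_normal_density_shift[of s m] s by (simp add: algebra_simps)
  then show ?thesis by (simp add: s1_def)
qed

lemma mixture_vol_ode:
  fixes m :: real
  defines "s \<equiv> mixture_vol m" and "s1 \<equiv> deriv mixture_vol m" and "s2 \<equiv> (deriv ^^ 2) mixture_vol m"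
  shows "s2 = - 1 / s + 2 * m * s1 / s\<^sup>2 - m\<^sup>2 * s1\<^sup>2 / s ^ 3 + s * s1\<^sup>2 / 4
    + exp (m\<^sup>2 / (2 * s\<^sup>2) + s\<^sup>2 / 8) * (\<Sum>i\<in>I. w i / v i * exp (- m\<^sup>2 / (2 * (v i)\<^sup>2) - (v i)\<^sup>2 / 8))"
proof -
  have s: "s > 0" by (simp add: s_def mixture_vol_pos)
  have ds: "(mixture_vol has_real_derivative s1) (at m)"
    using mixture_vol_has_deriv[of 0 m] by (simp add: s1_def)
  have ds1: "(deriv mixture_vol has_real_derivative s2) (at m)"
    using mixture_vol_has_deriv[of 1 m] by (simp add: s2_def numeral_2_eq_2)
  \<comment> \<open>These are d_2 at the solution and its derivative in \<open>m\<close> along the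
    solution.\<close>
  define d where "d = m / s - s / 2"
  define d' where "d' = (s - m * s1) / s\<^sup>2 - s1 / 2"
  define \<phi> where "\<phi> = std_normal_density d"
  have \<phi>: "\<phi> > 0" by (simp add: \<phi>_def std_normal_density_pos)
  have dens': "(std_normal_density has_real_derivative - x * std_normal_density x) (at x)" for x
    unfolding std_normal_density_def by (auto intro!: derivative_eq_intros simp: field_simps)
  have dd: "((\<lambda>m. m / mixture_vol m - mixture_vol m / 2) has_real_derivative d') (at m)"
    by (rule derivative_eq_intros ds refl | (use s in \<open>simp add: s_def d'_def power2_eq_square\<close>))+
  have d_eq: "d = m / mixture_vol m - mixture_vol m / 2"
    by (simp add: d_def s_def)
  have "((\<lambda>m. Phi (m / mixture_vol m - mixture_vol m / 2)
        + std_normal_density (m / mixture_vol m - mixture_vol m / 2) * deriv mixture_vol m)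
      has_real_derivative \<phi> * d' + ((- d * \<phi> * d') * s1 + s2 * \<phi>)) (at m)"
    unfolding \<phi>_def d_eq s1_def
    by (intro DERIV_add DERIV_mult DERIV_chain2[OF Phi_has_real_derivative dd] DERIV_chain2[OF dens' dd] ds1)
  moreover have "((\<lambda>m. \<Sum>i\<in>I. w i * Phi (m / v i - v i / 2)) has_real_derivative
      (\<Sum>i\<in>I. w i * (std_normal_density (m / v i - v i / 2) * (1 / v i)))) (at m)"
    by (intro DERIV_sum DERIV_cmult DERIV_chain2[OF Phi_has_real_derivative])
       (auto intro!: derivative_eq_intros simp: v_nz)
  ultimately have eq: "\<phi> * d' + ((- d * \<phi> * d') * s1 + s2 * \<phi>)
      = (\<Sum>i\<in>I. w i * (std_normal_density (m / v i - v i / 2) * (1 / v i)))"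
    unfolding mixture_vol_first_order by (rule DERIV_unique)
  \<comment> \<open>Expanding the squares, the cross term contributes \<open>m / 2\<close> to both
    exponents and cancels in the quotient, so only \<open>m\<^sup>2\<close> survives.\<close>
  have ratio: "w i * (std_normal_density (m / v i - v i / 2) * (1 / v i)) =
      \<phi> * (exp (m\<^sup>2 / (2 * s\<^sup>2) + s\<^sup>2 / 8) * (w i / v i * exp (- m\<^sup>2 / (2 * (v i)\<^sup>2) - (v i)\<^sup>2 / 8)))"
    if "i \<in> I" for i
  proof -
    have "- d\<^sup>2 / 2 + (m\<^sup>2 / (2 * s\<^sup>2) + s\<^sup>2 / 8 + (- m\<^sup>2 / (2 * (v i)\<^sup>2) - (v i)\<^sup>2 / 8))
        = - (m / v i - v i / 2)\<^sup>2 / 2"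
      using s v_pos[OF that] by (simp add: d_def power2_diff power_divide power2_eq_square field_simps)
    then have "exp (- (m / v i - v i / 2)\<^sup>2 / 2) = exp (- d\<^sup>2 / 2) *
      (exp (m\<^sup>2 / (2 * s\<^sup>2) + s\<^sup>2 / 8) * exp (- m\<^sup>2 / (2 * (v i)\<^sup>2) - (v i)\<^sup>2 / 8))"
      unfolding exp_add[symmetric] by simp
    then show ?thesis by (simp add: \<phi>_def std_normal_density_def)
  qed
  have "\<phi> * (d' - d * d' * s1 + s2) = \<phi> * (exp (m\<^sup>2 / (2 * s\<^sup>2) + s\<^sup>2 / 8) *
      (\<Sum>i\<in>I. w i / v i * exp (- m\<^sup>2 / (2 * (v i)\<^sup>2) - (v i)\<^sup>2 / 8)))"
  proof -
    have "\<phi> * (d' - d * d' * s1 + s2) = \<phi> * d' + ((- d * \<phi> * d') * s1 + s2 * \<phi>)"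
      by (simp add: algebra_simps)
    also note eq
    also note sum.cong[OF refl ratio]
    finally show ?thesis by (simp only: sum_distrib_left)
  qed
  then have "s2 = - d' + d * d' * s1 + exp (m\<^sup>2 / (2 * s\<^sup>2) + s\<^sup>2 / 8) *
      (\<Sum>i\<in>I. w i / v i * exp (- m\<^sup>2 / (2 * (v i)\<^sup>2) - (v i)\<^sup>2 / 8))"
    using \<phi> by simp
  also have "- d' + d * d' * s1 =
      - 1 / s + 2 * m * s1 / s\<^sup>2 - m\<^sup>2 * s1\<^sup>2 / s ^ 3 + s * s1\<^sup>2 / 4"
    using s by (simp add: d_def d'_def power2_eq_square power3_eq_cube field_simps)
  finally show ?thesis .
qed

end

section \<open>Coefficients of even power series\<close>

text \<open>Evenness is required only up to order 4: the coefficient of order 4 of the second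
  derivative already determines the coefficient of order 6 of the solution. The odd parts of the
  conclusion let the rule be iterated.\<close>

lemma fps_even_mult:
  fixes F G :: "'a :: comm_ring_1 fps"
  assumes "F $ 1 = 0" "F $ 3 = 0" "G $ 1 = 0" "G $ 3 = 0"
  shows "(F * G) $ 0 = F $ 0 * G $ 0" and "(F * G) $ 1 = 0"
    and "(F * G) $ 2 = F $ 0 * G $ 2 + F $ 2 * G $ 0" and "(F * G) $ 3 = 0"
    and "(F * G) $ 4 = F $ 0 * G $ 4 + F $ 2 * G $ 2 + F $ 4 * G $ 0"
  using assms by (simp_all add: fps_mult_nth eval_nat_numeral)

lemma fps_even_inverse:
  fixes F :: "'a :: field fps"
  assumes nz: "F $ 0 \<noteq> 0" and odd: "F $ 1 = 0" "F $ 3 = 0"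
  shows "inverse F $ 0 = 1 / F $ 0" and "inverse F $ 1 = 0"
    and "inverse F $ 2 = - F $ 2 / (F $ 0)\<^sup>2" and "inverse F $ 3 = 0"
    and "inverse F $ 4 = ((F $ 2)\<^sup>2 / F $ 0 - F $ 4) / (F $ 0)\<^sup>2"
proof -
  have one: "(inverse F * F) $ n = (1 :: 'a fps) $ n" for n
    using nz by (simp add: inverse_mult_eq_1)
  show 0: "inverse F $ 0 = 1 / F $ 0" by (simp add: field_simps)
  show 1: "inverse F $ 1 = 0"
    using one[of 1] nz odd by (simp add: fps_mult_nth)
  show 2: "inverse F $ 2 = - F $ 2 / (F $ 0)\<^sup>2"
    using one[of 2] nz odd 0 1
    by (simp add: fps_mult_nth eval_nat_numeral field_simps) (simp add: eq_neg_iff_add_eq_0 add_ac)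
  show 3: "inverse F $ 3 = 0"
    using one[of 3] nz odd 1 by (simp add: fps_mult_nth eval_nat_numeral)
  have "inverse F $ 4 * F $ 0 + inverse F $ 2 * F $ 2 + inverse F $ 0 * F $ 4 = 0"
    using one[of 4] fps_even_mult(5)[OF 1 3 odd] by (simp add: add_ac)
  then show "inverse F $ 4 = ((F $ 2)\<^sup>2 / F $ 0 - F $ 4) / (F $ 0)\<^sup>2"
    using nz unfolding 0 2 by (simp add: field_simps power2_eq_square)
qed

text \<open>The exponential \<open>T\<close> of \<open>A\<close> satisfies
  \<open>fps_deriv T = T * fps_deriv A\<close>, a recursion for its coefficients.\<close>

lemma fps_even_exp:
  fixes A :: "'a :: field_char_0 fps"
  assumes "A $ 0 = 0" "A $ 1 = 0" "A $ 3 = 0"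
  shows "(fps_exp 1 oo A) $ 0 = 1" and "(fps_exp 1 oo A) $ 1 = 0"
    and "(fps_exp 1 oo A) $ 2 = A $ 2" and "(fps_exp 1 oo A) $ 3 = 0"
    and "(fps_exp 1 oo A) $ 4 = A $ 4 + (A $ 2)\<^sup>2 / 2"
proof -
  define T where "T = fps_exp 1 oo A"
  have "fps_deriv T = T * fps_deriv A"
    using fps_compose_deriv[OF assms(1), of "fps_exp 1"] by (simp add: T_def)
  then have rec: "of_nat (n + 1) * T $ (n + 1) = (T * fps_deriv A) $ n" for n
    by (metis fps_deriv_nth)
  show 0: "T $ 0 = 1" by (simp add: T_def)
  show 1: "T $ 1 = 0" using rec[of 0] assms by simp
  show 2: "T $ 2 = A $ 2" using rec[of 1] assms 0 1 by (simp add: fps_mult_nth numeral_2_eq_2)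
  show 3: "T $ 3 = 0" using rec[of 2] assms 0 1 2
    by (simp add: fps_mult_nth eval_nat_numeral)
  have "4 * T $ 4 = 4 * (A $ 4 + (A $ 2)\<^sup>2 / 2)"
    using rec[of 3] assms 0 1 2 3 by (simp add: fps_mult_nth eval_nat_numeral algebra_simps)
  then show "T $ 4 = A $ 4 + (A $ 2)\<^sup>2 / 2" by (simp only: mult_cancel_left) simp
qed

text \<open>The constant \<open>\<kappa>\<close> only serves to make the constant term of \<open>A\<close> vanish, so that the composition
  with the exponential series is meaningful.\<close>
lemma vol_ode_coefficients:
  fixes S K A :: "'a :: field_char_0 fps" and \<kappa> :: 'a
  defines "U \<equiv> inverse S"
  assumes S0: "S $ 0 \<noteq> 0" and S_odd: "S $ 1 = 0" "S $ 3 = 0" "S $ 5 = 0"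
    and K_odd: "K $ 1 = 0" "K $ 3 = 0"
    and A: "A = fps_const (1 / 2) * fps_X\<^sup>2 * U\<^sup>2 + fps_const (1 / 8) * S\<^sup>2 - fps_const \<kappa>" and A0: "A $ 0 = 0"
    and ode: "fps_deriv (fps_deriv S) = - U + 2 * (fps_X * fps_deriv S) * U\<^sup>2
      - (fps_X * fps_deriv S)\<^sup>2 * U ^ 3 + fps_const (1 / 4) * S * (fps_deriv S)\<^sup>2 + (fps_exp 1 oo A) * K"
  defines "a \<equiv> S $ 0" and "b \<equiv> S $ 2" and "c \<equiv> S $ 4" and "d \<equiv> S $ 6"
  defines "\<alpha> \<equiv> 1 / (2 * a\<^sup>2) + a * b / 4" and "\<beta> \<equiv> - b / a ^ 3 + (b\<^sup>2 + 2 * a * c) / 8"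
  shows "2 * b = - 1 / a + K $ 0"
    and "12 * c = 5 * b / a\<^sup>2 + a * b\<^sup>2 + \<alpha> * K $ 0 + K $ 2"
    and "30 * d = - b\<^sup>2 / a ^ 3 + c / a\<^sup>2 + (8 * c - 8 * b\<^sup>2 / a) / a\<^sup>2 - 4 * b\<^sup>2 / a ^ 3 + b ^ 3 + 4 * a * b * c
      + (\<beta> + \<alpha>\<^sup>2 / 2) * K $ 0 + \<alpha> * K $ 2 + K $ 4"
proof -
  have a: "a \<noteq> 0" using S0 by (simp add: a_def)
  note U = fps_even_inverse[OF S0 S_odd(1,2), folded U_def a_def b_def c_def]
  have S: "S $ 0 = a" "S $ 1 = 0" "S $ 2 = b" "S $ 3 = 0" "S $ 4 = c"
    using S_odd by (simp_all add: a_def b_def c_def)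
  note UU = fps_even_mult[OF U(2,4) U(2,4)]
  note UUU = fps_even_mult[OF U(2,4) UU(2,4)]
  note SS = fps_even_mult[OF S(2,4) S(2,4)]
  define X2 where "X2 = (fps_X\<^sup>2 :: 'a fps)"
  have X2: "X2 $ 0 = 0" "X2 $ 1 = 0" "X2 $ 2 = 1" "X2 $ 3 = 0" "X2 $ 4 = 0"
    by (simp_all add: X2_def fps_X_power_nth)
  note XUU = fps_even_mult[OF X2(2,4) UU(2,4)]
  have A_nth: "A $ n = 1 / 2 * (X2 * (U * U)) $ n + 1 / 8 * (S * S) $ n - (if n = 0 then \<kappa> else 0)" for n
    unfolding A X2_def by (simp add: power2_eq_square mult.assoc)
  have A_odd: "A $ 1 = 0" "A $ 3 = 0"
    by (simp_all only: A_nth XUU SS) simp_all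
  have A2: "A $ 2 = \<alpha>"
    using a by (simp only: A_nth XUU SS UU U S X2) (simp add: \<alpha>_def S field_simps power2_eq_square)
  have A4: "A $ 4 = \<beta>"
    using a by (simp only: A_nth XUU SS UU U S X2) (simp add: \<beta>_def S field_simps power2_eq_square power3_eq_cube)
  note T = fps_even_exp[OF A0 A_odd, unfolded A2 A4]
  note TK = fps_even_mult[OF T(2,4) K_odd]
  \<comment> \<open>The derivative of \<open>S\<close> is odd, so the rules for even series do not
    apply to it. Grouping its occurrences into \<open>D\<close> and the square \<open>G\<close>
    leaves even factors only.\<close>
  define D where "D = fps_X * fps_deriv S"
  have D: "D $ 0 = 0" "D $ 1 = 0" "D $ 2 = 2 * b" "D $ 3 = 0" "D $ 4 = 4 * c"
    using S S_odd by (simp_all add: D_def eval_nat_numeral)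
  note DUU = fps_even_mult[OF D(2,4) UU(2,4)]
  note DD = fps_even_mult[OF D(2,4) D(2,4)]
  note DDUUU = fps_even_mult[OF DD(2,4) UUU(2,4)]
  define G where "G = fps_deriv S * fps_deriv S"
  have G: "G $ 0 = 0" "G $ 1 = 0" "G $ 2 = 4 * b\<^sup>2" "G $ 3 = 0" "G $ 4 = 16 * b * c"
    using S S_odd by (simp_all add: G_def fps_mult_nth eval_nat_numeral algebra_simps)
  note SG = fps_even_mult[OF S(2,4) G(2,4)]
  have lhs: "fps_deriv (fps_deriv S) $ n = of_nat (n + 1) * (of_nat (n + 2) * S $ (n + 2))" for n
    by (simp add: add_ac)
  \<comment> \<open>For \<open>n\<close> equal to 0, 2, 4 the factor on the left is 2, 12, 30, the
    numbers in the three conclusions.\<close>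
  have nth: "of_nat (n + 1) * (of_nat (n + 2) * S $ (n + 2)) = - (U $ n) + 2 * (D * (U * U)) $ n
      - (D * D * (U * (U * U))) $ n + 1 / 4 * (S * G) $ n + ((fps_exp 1 oo A) * K) $ n" for n
  proof -
    have "fps_deriv (fps_deriv S) = - U + fps_const 2 * (D * (U * U))
      - D * D * (U * (U * U)) + fps_const (1 / 4) * (S * G) + (fps_exp 1 oo A) * K"
      unfolding ode D_def G_def
      by (simp add: power2_eq_square power3_eq_cube mult.assoc numeral_fps_const)
    then show ?thesis unfolding lhs[symmetric] by simp
  qed
  show "2 * b = - 1 / a + K $ 0"
    using nth[of 0] by (simp only: DUU DDUUU SG TK UUU UU DD U S D G T) (simp add: b_def numeral_2_eq_2)
  have "12 * c = - (- b / a\<^sup>2) + 2 * (2 * b * (1 / a * (1 / a)))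
      + 1 / 4 * (a * (4 * b\<^sup>2)) + (K $ 2 + \<alpha> * K $ 0)"
    using nth[of 2] by (simp only: DUU DDUUU SG TK UUU UU DD U S D G T) (simp add: S flip: c_def)
  then show "12 * c = 5 * b / a\<^sup>2 + a * b\<^sup>2 + \<alpha> * K $ 0 + K $ 2"
    using a by (simp add: field_simps power2_eq_square)
  have "30 * d = - ((b\<^sup>2 / a - c) / a\<^sup>2)
      + 2 * (2 * b * (2 * (1 / a * (- b / a\<^sup>2))) + 4 * c * (1 / a * (1 / a)))
      - 4 * b\<^sup>2 * (1 / a * (1 / a * (1 / a)))
      + 1 / 4 * (a * (16 * b * c) + b * (4 * b\<^sup>2))
      + (K $ 4 + \<alpha> * K $ 2 + (\<beta> + \<alpha>\<^sup>2 / 2) * K $ 0)"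
    using nth[of 4] by (simp only: DUU DDUUU SG TK UUU UU DD U S D G T)
      (simp add: S d_def power2_eq_square algebra_simps)
  then show "30 * d = - b\<^sup>2 / a ^ 3 + c / a\<^sup>2 + (8 * c - 8 * b\<^sup>2 / a) / a\<^sup>2 - 4 * b\<^sup>2 / a ^ 3 + b ^ 3 + 4 * a * b * c
      + (\<beta> + \<alpha>\<^sup>2 / 2) * K $ 0 + \<alpha> * K $ 2 + K $ 4"
    by (simp add: power2_eq_square power3_eq_cube algebra_simps diff_divide_distrib)
qed

text \<open>Lagrange's remainder, with the derivative of order \<open>n\<close> bounded on the
  compact interval from -1 to 1.\<close>

lemma taylor_remainder_bigo:
  fixes f :: "real \<Rightarrow> real"
  assumes smooth: "\<And>k x. (deriv ^^ k) f field_differentiable at x"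
  shows "(\<lambda>x. f x - (\<Sum>k<n. (deriv ^^ k) f 0 / fact k * x ^ k)) \<in> O[nhds 0](\<lambda>x. x ^ n)"
proof -
  have D: "((deriv ^^ k) f has_real_derivative (deriv ^^ Suc k) f x) (at x)" for k x
    using smooth by (simp add: DERIV_deriv_iff_field_differentiable)
  have "continuous_on {- 1..1} ((deriv ^^ n) f)"
    using D by (intro continuous_at_imp_continuous_on ballI DERIV_isCont) blast
  then have "bounded ((deriv ^^ n) f ` {- 1..1})"
    by (intro compact_imp_bounded compact_continuous_image) auto
  then obtain B where B: "\<And>x. x \<in> {- 1..1} \<Longrightarrow> \<bar>(deriv ^^ n) f x\<bar> \<le> B"
    unfolding bounded_iff by (metis image_eqI real_norm_def)
  have bound: "\<bar>f x - (\<Sum>k<n. (deriv ^^ k) f 0 / fact k * x ^ k)\<bar> \<le> B / fact n * \<bar>x ^ n\<bar>"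
    if x: "x \<in> {- 1..1}" for x
  proof -
    obtain t where t: "\<bar>t\<bar> \<le> \<bar>x\<bar>"
      and eq: "f x = (\<Sum>k<n. (deriv ^^ k) f 0 / fact k * x ^ k) + (deriv ^^ n) f t / fact n * x ^ n"
      using Maclaurin_all_le[of "\<lambda>k. (deriv ^^ k) f" f x n] D by auto
    have "\<bar>(deriv ^^ n) f t\<bar> \<le> B" using t x by (intro B) auto
    then show ?thesis
      by (subst eq) (simp add: abs_mult divide_right_mono mult_right_mono)
  qed
  have "\<forall>\<^sub>F x :: real in nhds 0. x \<in> {- 1<..<1}"
    by (rule eventually_nhds_in_open) auto
  then have "\<forall>\<^sub>F x in nhds 0. norm (f x - (\<Sum>k<n. (deriv ^^ k) f 0 / fact k * x ^ k)) \<le> B / fact n * norm (x ^ n)"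
    unfolding real_norm_def by eventually_elim (rule bound, simp)
  then show ?thesis by (rule bigoI)
qed

text \<open>\<open>M1\<close>, \<open>M3\<close>, \<open>M5\<close> stand for the sums of w_n E_n /
  H_n^j with j = 1, 3, 5. They enter the three recursions linearly and in triangular form, so they
  can be eliminated in favour of \<open>b\<close>, \<open>c\<close>, \<open>d\<close>; what remains
  are rational identities in \<open>s\<close>, \<open>b\<close>, \<open>c\<close>,
  \<open>d\<close>.\<close>

lemma vol_coefficients_closed_form:
  fixes s b c d M1 M3 M5 :: real
  assumes s: "s > 0"
    and eq1: "2 * b = - 1 / s + M1 / 2"
    and eq2: "12 * c = 5 * b / s\<^sup>2 + s * b\<^sup>2 + (1 / (2 * s\<^sup>2) + s * b / 4) * (M1 / 2) - M3 / 16"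
    and eq3: "30 * d = - b\<^sup>2 / s ^ 3 + c / s\<^sup>2 + (8 * c - 8 * b\<^sup>2 / s) / s\<^sup>2 - 4 * b\<^sup>2 / s ^ 3 + b ^ 3 + 4 * s * b * c
      + (- b / s ^ 3 + (b\<^sup>2 + 2 * s * c) / 8 + (1 / (2 * s\<^sup>2) + s * b / 4)\<^sup>2 / 2) * (M1 / 2)
      - (1 / (2 * s\<^sup>2) + s * b / 4) * (M3 / 16) + M5 / 256"
  defines "\<Sigma>\<^sub>0 \<equiv> s / 2" and "\<Sigma>\<^sub>2 \<equiv> s * (2 * b)" and "\<Sigma>\<^sub>4 \<equiv> s * (24 * c)"
  shows "2 * b = 1 / 2 * (- 1 / \<Sigma>\<^sub>0 + M1)"
    and "24 * c = 1 / 8 * ((1 + 6 * \<Sigma>\<^sub>2 + \<Sigma>\<^sub>0 ^ 2 * (- 7 - 6 * \<Sigma>\<^sub>2 + 3 * \<Sigma>\<^sub>2 ^ 2)) / \<Sigma>\<^sub>0 ^ 3 + (7 * M1 - M3))"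
    and "720 * d = 1 / 32 *
          ((- 3 - 45 * \<Sigma>\<^sub>2 + \<Sigma>\<^sub>0 ^ 2 * (90 * \<Sigma>\<^sub>2 + 60 * \<Sigma>\<^sub>4)
              + \<Sigma>\<^sub>0 ^ 4 * \<Sigma>\<^sub>2 * (45 * \<Sigma>\<^sub>2 + 60 * \<Sigma>\<^sub>4 - 15 * \<Sigma>\<^sub>2 ^ 2)) / \<Sigma>\<^sub>0 ^ 5
           + (16 * \<Sigma>\<^sub>0 ^ 2 - 90 * \<Sigma>\<^sub>2 ^ 2 - 31 * \<Sigma>\<^sub>0 ^ 4 - 45 * \<Sigma>\<^sub>0 ^ 2 * \<Sigma>\<^sub>2 ^ 2
              - \<Sigma>\<^sub>0 ^ 4 * (15 * \<Sigma>\<^sub>2 + 60 * \<Sigma>\<^sub>4) + 15 * \<Sigma>\<^sub>0 ^ 2 * \<Sigma>\<^sub>2 ^ 3) / \<Sigma>\<^sub>0 ^ 5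
           + (3 * M5 - 16 * M3 + 31 * M1))"
proof -
  have M1: "M1 = 4 * b + 2 / s" using eq1 by simp
  have M3: "M3 = 16 * (5 * b / s\<^sup>2 + s * b\<^sup>2 + (1 / (2 * s\<^sup>2) + s * b / 4) * (M1 / 2) - 12 * c)"
    using eq2 by simp
  have M5: "M5 = 256 * (30 * d - (- b\<^sup>2 / s ^ 3 + c / s\<^sup>2 + (8 * c - 8 * b\<^sup>2 / s) / s\<^sup>2 - 4 * b\<^sup>2 / s ^ 3 + b ^ 3 + 4 * s * b * c
      + (- b / s ^ 3 + (b\<^sup>2 + 2 * s * c) / 8 + (1 / (2 * s\<^sup>2) + s * b / 4)\<^sup>2 / 2) * (M1 / 2)
      - (1 / (2 * s\<^sup>2) + s * b / 4) * (M3 / 16)))"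
    using eq3 by simp
  show "2 * b = 1 / 2 * (- 1 / \<Sigma>\<^sub>0 + M1)"
    using s by (simp add: \<Sigma>\<^sub>0_def M1)
  show "24 * c = 1 / 8 * ((1 + 6 * \<Sigma>\<^sub>2 + \<Sigma>\<^sub>0 ^ 2 * (- 7 - 6 * \<Sigma>\<^sub>2 + 3 * \<Sigma>\<^sub>2 ^ 2)) / \<Sigma>\<^sub>0 ^ 3 + (7 * M1 - M3))"
    using s unfolding M3 M1 \<Sigma>\<^sub>0_def \<Sigma>\<^sub>2_def
    by (simp add: field_simps power2_eq_square power3_eq_cube)
  \<comment> \<open>The name \<open>r\<close> sorts directly before \<open>s\<close>, so that AC-rewriting brings the two together.\<close>
  define r where "r = 1 / s"
  have div: "x / s = x * r" "x / s\<^sup>2 = x * r\<^sup>2" "x / s ^ 3 = x * r ^ 3" for x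
    by (simp_all add: r_def power_divide)
  have div2: "1 / (2 * s\<^sup>2) = r\<^sup>2 / 2" by (simp add: r_def power_divide)
  have div5: "x / \<Sigma>\<^sub>0 ^ 5 = 32 * x * r ^ 5" for x by (simp add: r_def \<Sigma>\<^sub>0_def power_divide)
  have ar: "r * s = 1" using s by (simp add: r_def)
  have ar': "r * (s * x) = x" for x using ar by (metis mult.assoc mult_1)
  show "720 * d = 1 / 32 *
          ((- 3 - 45 * \<Sigma>\<^sub>2 + \<Sigma>\<^sub>0 ^ 2 * (90 * \<Sigma>\<^sub>2 + 60 * \<Sigma>\<^sub>4)
              + \<Sigma>\<^sub>0 ^ 4 * \<Sigma>\<^sub>2 * (45 * \<Sigma>\<^sub>2 + 60 * \<Sigma>\<^sub>4 - 15 * \<Sigma>\<^sub>2 ^ 2)) / \<Sigma>\<^sub>0 ^ 5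
           + (16 * \<Sigma>\<^sub>0 ^ 2 - 90 * \<Sigma>\<^sub>2 ^ 2 - 31 * \<Sigma>\<^sub>0 ^ 4 - 45 * \<Sigma>\<^sub>0 ^ 2 * \<Sigma>\<^sub>2 ^ 2
              - \<Sigma>\<^sub>0 ^ 4 * (15 * \<Sigma>\<^sub>2 + 60 * \<Sigma>\<^sub>4) + 15 * \<Sigma>\<^sub>0 ^ 2 * \<Sigma>\<^sub>2 ^ 3) / \<Sigma>\<^sub>0 ^ 5
           + (3 * M5 - 16 * M3 + 31 * M1))"
    unfolding M5[unfolded div div2] M3[unfolded div div2] M1[unfolded div] div5
    unfolding \<Sigma>\<^sub>0_def \<Sigma>\<^sub>2_def \<Sigma>\<^sub>4_def
    by (simp add: eval_nat_numeral ring_distribs mult_ac add_divide_distrib diff_divide_distrib ar ar')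
qed

context vol_mixture
begin

text \<open>The exponent in the differential equation has the constant term
  \<open>a\<^sup>2 / 8\<close>. It is moved into the weights \<open>\<kappa>\<close>, and
  \<open>k0\<close>, \<open>k2\<close>, \<open>k4\<close> are the coefficients of the series
  \<open>\<Sum>i\<in>I. \<kappa> i * exp (- x\<^sup>2 / (2 * (v i)\<^sup>2))\<close>. The comparison
  takes place over the complex numbers, where \<open>h\<close> lives, and returns by injectivity of
  \<open>of_real\<close>.\<close>

lemma mixture_vol_coefficients:
  defines "a \<equiv> mixture_vol 0" and "b \<equiv> (deriv ^^ 2) mixture_vol 0 / fact 2"
    and "c \<equiv> (deriv ^^ 4) mixture_vol 0 / fact 4" and "d \<equiv> (deriv ^^ 6) mixture_vol 0 / fact 6"
    and "\<kappa> \<equiv> \<lambda>i. w i / v i * exp (((mixture_vol 0)\<^sup>2 - (v i)\<^sup>2) / 8)"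
  defines "k0 \<equiv> \<Sum>i\<in>I. \<kappa> i" and "k2 \<equiv> \<Sum>i\<in>I. \<kappa> i * (- 1 / (2 * (v i)\<^sup>2))"
    and "k4 \<equiv> \<Sum>i\<in>I. \<kappa> i * (1 / (8 * v i ^ 4))"
  defines "\<alpha> \<equiv> 1 / (2 * a\<^sup>2) + a * b / 4" and "\<beta> \<equiv> - b / a ^ 3 + (b\<^sup>2 + 2 * a * c) / 8"
  shows "2 * b = - 1 / a + k0"
    and "12 * c = 5 * b / a\<^sup>2 + a * b\<^sup>2 + \<alpha> * k0 + k2"
    and "30 * d = - b\<^sup>2 / a ^ 3 + c / a\<^sup>2 + (8 * c - 8 * b\<^sup>2 / a) / a\<^sup>2 - 4 * b\<^sup>2 / a ^ 3 + b ^ 3 + 4 * a * b * c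
      + (\<beta> + \<alpha>\<^sup>2 / 2) * k0 + \<alpha> * k2 + k4"
proof -
  let ?c = "complex_of_real"
  have a: "a > 0" by (simp add: a_def mixture_vol_pos)
  obtain h where h: "real_extends_at h mixture_vol 0"
    using mixture_vol_real_extends by blast
  define S where "S = fps_expansion h 0"
  note hS = real_extends_at_fps_expansion(1)[OF h, folded S_def]
  note S_nth = real_extends_at_fps_expansion(2)[OF h, folded S_def]
  have S: "S $ 0 = ?c a" "S $ 2 = ?c b" "S $ 4 = ?c c" "S $ 6 = ?c d"
    unfolding S_nth a_def b_def c_def d_def by simp_all
  have S_odd: "S $ 1 = 0" "S $ 3 = 0" "S $ 5 = 0"
    unfolding S_nth using mixture_vol_odd_deriv_0[of 1] mixture_vol_odd_deriv_0[of 3]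
      mixture_vol_odd_deriv_0[of 5] by simp_all
  have S0: "S $ 0 \<noteq> 0" using a S by simp
  define U where "U = inverse S"
  have hU: "(\<lambda>z. inverse (h z)) has_fps_expansion U"
    unfolding U_def by (rule has_fps_expansion_inverse[OF hS S0])
  define A where "A = fps_const (1 / 2) * fps_X\<^sup>2 * U\<^sup>2 + fps_const (1 / 8) * S\<^sup>2 - fps_const (?c (a\<^sup>2 / 8))"
  define gA where "gA = (\<lambda>z. 1 / 2 * z\<^sup>2 * (inverse (h z))\<^sup>2 + 1 / 8 * (h z)\<^sup>2 - ?c (a\<^sup>2 / 8))"
  have gA: "gA has_fps_expansion A"
    unfolding gA_def A_def by (intro fps_expansion_intros hU hS)
  have A0: "A $ 0 = 0"
    unfolding A_def by (simp add: fps_mult_nth power2_eq_square S)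
  define T where "T = (\<lambda>i. fps_exp 1 oo (fps_const (?c (- 1 / (2 * (v i)\<^sup>2))) * fps_X\<^sup>2))"
  define K where "K = (\<Sum>i\<in>I. fps_const (?c (\<kappa> i)) * T i)"
  define gK where "gK = (\<lambda>z. \<Sum>i\<in>I. ?c (\<kappa> i) * (exp \<circ> (\<lambda>z. ?c (- 1 / (2 * (v i)\<^sup>2)) * z\<^sup>2)) z)"
  have gK: "gK has_fps_expansion K"
    unfolding gK_def K_def T_def
    by (intro fps_expansion_intros has_fps_expansion_compose[OF has_fps_expansion_exp1]) simp
  have T: "T i $ 0 = 1" "T i $ 1 = 0" "T i $ 2 = ?c (- 1 / (2 * (v i)\<^sup>2))" "T i $ 3 = 0"
    "T i $ 4 = ?c (1 / (8 * v i ^ 4))" for i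
    using fps_even_exp[of "fps_const (?c (- 1 / (2 * (v i)\<^sup>2))) * fps_X\<^sup>2"]
    by (simp_all add: T_def fps_X_power_nth power_divide power_mult_distrib power_mult flip: power_mult)
  have K: "K $ 0 = ?c k0" "K $ 1 = 0" "K $ 2 = ?c k2" "K $ 3 = 0" "K $ 4 = ?c k4"
    unfolding K_def by (simp_all add: fps_sum_nth T[unfolded One_nat_def] k0_def k2_def k4_def)
  define L where "L = - U + 2 * (fps_X * fps_deriv S) * U\<^sup>2
      - (fps_X * fps_deriv S)\<^sup>2 * U ^ 3 + fps_const (1 / 4) * S * (fps_deriv S)\<^sup>2 + (fps_exp 1 oo A) * K"
  define gL where "gL = (\<lambda>z. - inverse (h z) + 2 * (z * deriv h z) * (inverse (h z))\<^sup>2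
      - (z * deriv h z)\<^sup>2 * (inverse (h z)) ^ 3 + 1 / 4 * h z * (deriv h z)\<^sup>2 + (exp \<circ> gA) z * gK z)"
  have gL: "gL has_fps_expansion L"
    unfolding gL_def L_def
    by (intro fps_expansion_intros hU hS gK has_fps_expansion_compose[OF has_fps_expansion_exp1 gA A0])
  \<comment> \<open>Both sides expand analytic functions that agree at real points near 0 by
    \<open>mixture_vol_ode\<close>.\<close>
  have ode: "fps_deriv (fps_deriv S) = L"
  proof (rule has_fps_expansion_unique_real[OF _ gL])
    show "deriv (deriv h) has_fps_expansion fps_deriv (fps_deriv S)"
      by (intro has_fps_expansion_deriv hS)
    have "\<forall>\<^sub>F x in nhds 0. h (of_real x) = of_real (mixture_vol x)"
      "\<forall>\<^sub>F x in nhds 0. deriv h (of_real x) = of_real (deriv mixture_vol x)"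
      "\<forall>\<^sub>F x in nhds 0. deriv (deriv h) (of_real x) = of_real ((deriv ^^ 2) mixture_vol x)"
      using h real_extends_at_higher_deriv[OF h, of 1] real_extends_at_higher_deriv[OF h, of 2]
      by (simp_all add: real_extends_at_def numeral_2_eq_2)
    then show "\<forall>\<^sub>F x in nhds 0. deriv (deriv h) (of_real x) = gL (of_real x)"
    proof eventually_elim
      case (elim x)
      define s where "s = mixture_vol x"
      define s1 where "s1 = deriv mixture_vol x"
      define eA where "eA = exp (x\<^sup>2 / (2 * s\<^sup>2) + s\<^sup>2 / 8 - a\<^sup>2 / 8)"
      define rK where "rK = (\<Sum>i\<in>I. \<kappa> i * exp (- x\<^sup>2 / (2 * (v i)\<^sup>2)))"
      have hs: "h (of_real x) = of_real s" "deriv h (of_real x) = of_real s1"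
        using elim by (simp_all add: s_def s1_def)
      have "gA (of_real x) = of_real (x\<^sup>2 / (2 * s\<^sup>2) + s\<^sup>2 / 8 - a\<^sup>2 / 8)"
        by (simp add: gA_def hs power_inverse divide_simps)
      then have e: "(exp \<circ> gA) (of_real x) = of_real eA"
        by (simp add: eA_def flip: exp_of_real)
      have k: "gK (of_real x) = of_real rK"
        by (simp add: gK_def rK_def flip: exp_of_real)
      have g: "gL (of_real x) = of_real (- inverse s + 2 * (x * s1) * (inverse s)\<^sup>2
          - (x * s1)\<^sup>2 * inverse s ^ 3 + 1 / 4 * s * s1\<^sup>2 + eA * rK)"
        unfolding gL_def hs e k by simp
      \<comment> \<open>The factor exp(-a^2/8) in \<open>eA\<close> and its inverse inside
        \<open>\<kappa>\<close> cancel.\<close>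
      have p: "eA * rK = exp (x\<^sup>2 / (2 * s\<^sup>2) + s\<^sup>2 / 8) *
          (\<Sum>i\<in>I. w i / v i * exp (- x\<^sup>2 / (2 * (v i)\<^sup>2) - (v i)\<^sup>2 / 8))"
      proof -
        have "eA * (\<kappa> i * exp (- x\<^sup>2 / (2 * (v i)\<^sup>2))) = exp (x\<^sup>2 / (2 * s\<^sup>2) + s\<^sup>2 / 8) *
          (w i / v i * exp (- x\<^sup>2 / (2 * (v i)\<^sup>2) - (v i)\<^sup>2 / 8))" for i
        proof -
          have "eA * (exp ((a\<^sup>2 - (v i)\<^sup>2) / 8) * exp (- x\<^sup>2 / (2 * (v i)\<^sup>2))) =
              exp (x\<^sup>2 / (2 * s\<^sup>2) + s\<^sup>2 / 8) * exp (- x\<^sup>2 / (2 * (v i)\<^sup>2) - (v i)\<^sup>2 / 8)"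
            unfolding eA_def exp_add[symmetric]
            by (rule arg_cong[where f = exp]) (simp add: diff_divide_distrib)
          then have "w i / v i * (eA * (exp ((a\<^sup>2 - (v i)\<^sup>2) / 8) * exp (- x\<^sup>2 / (2 * (v i)\<^sup>2)))) =
              w i / v i * (exp (x\<^sup>2 / (2 * s\<^sup>2) + s\<^sup>2 / 8) * exp (- x\<^sup>2 / (2 * (v i)\<^sup>2) - (v i)\<^sup>2 / 8))"
            by simp
          then show ?thesis unfolding \<kappa>_def a_def by (simp only: mult_ac)
        qed
        then show ?thesis by (simp only: rK_def sum_distrib_left)
      qed
      have q: "- inverse s + 2 * (x * s1) * (inverse s)\<^sup>2 - (x * s1)\<^sup>2 * inverse s ^ 3 + 1 / 4 * s * s1\<^sup>2
          = - 1 / s + 2 * x * s1 / s\<^sup>2 - x\<^sup>2 * s1\<^sup>2 / s ^ 3 + s * s1\<^sup>2 / 4"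
        using mixture_vol_pos[of x] by (simp add: s_def[symmetric] field_simps power2_eq_square power3_eq_cube)
      show ?case
        unfolding g p q elim(3) mixture_vol_ode[of x, folded s_def s1_def] ..
    qed
  qed
  note coeffs = vol_ode_coefficients[of S K A "?c (a\<^sup>2 / 8)", OF S0 S_odd K(2,4),
      folded U_def, OF A_def A0 ode[unfolded L_def], unfolded S K]
  have "?c (2 * b) = ?c (- 1 / a + k0)"
    using coeffs(1) by simp
  then show "2 * b = - 1 / a + k0" by (simp only: of_real_eq_iff)
  have "?c (12 * c) = ?c (5 * b / a\<^sup>2 + a * b\<^sup>2 + \<alpha> * k0 + k2)"
    using coeffs(2) by (simp add: \<alpha>_def)
  then show "12 * c = 5 * b / a\<^sup>2 + a * b\<^sup>2 + \<alpha> * k0 + k2" by (simp only: of_real_eq_iff)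
  have "?c (30 * d) = ?c (- b\<^sup>2 / a ^ 3 + c / a\<^sup>2 + (8 * c - 8 * b\<^sup>2 / a) / a\<^sup>2 - 4 * b\<^sup>2 / a ^ 3 + b ^ 3 + 4 * a * b * c
      + (\<beta> + \<alpha>\<^sup>2 / 2) * k0 + \<alpha> * k2 + k4)"
    using coeffs(3) by (simp add: \<alpha>_def \<beta>_def)
  then show "30 * d = - b\<^sup>2 / a ^ 3 + c / a\<^sup>2 + (8 * c - 8 * b\<^sup>2 / a) / a\<^sup>2 - 4 * b\<^sup>2 / a ^ 3 + b ^ 3 + 4 * a * b * c
      + (\<beta> + \<alpha>\<^sup>2 / 2) * k0 + \<alpha> * k2 + k4" by (simp only: of_real_eq_iff)
qed

end

section \<open>Black-Scholes prices\<close>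

lemma discounted_strike:
  fixes r S0 T K :: real
  assumes "S0 > 0" "K > 0"
  shows "K * exp (- r * T) = S0 * exp (- (ln (S0 / K) + r * T))"
proof -
  have "exp (- (ln (S0 / K) + r * T)) = exp (- ln (S0 / K)) * exp (- r * T)"
    by (simp flip: exp_add)
  also have "exp (- ln (S0 / K)) = K / S0"
    using assms by (simp add: exp_minus)
  finally show ?thesis using assms by simp
qed

text \<open>Put-call parity: the correction for puts is free of \<open>\<sigma>\<close>, so calls
  and puts lead to the same implied volatility, also for mixtures of total weight 1.\<close>

lemma BS_eq_call_price:
  fixes r S0 T K \<sigma> :: real
  assumes pos: "S0 > 0" "T > 0" "K > 0" "\<sigma> > 0"
  defines "m \<equiv> ln (S0 / K) + r * T"
  shows "BS r cp 0 S0 T K \<sigma> =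
    S0 * (call_price m (\<sigma> * sqrt T) + (case cp of Call \<Rightarrow> 0 | Put \<Rightarrow> exp (- m) - 1))"
proof -
  define q where "q = sqrt T"
  have q: "q > 0" "q\<^sup>2 = T" using pos by (simp_all add: q_def)
  have disc: "K * exp (- r * T) = S0 * exp (- m)"
    unfolding m_def using pos by (intro discounted_strike)
  have d1: "(ln (S0 / K) + (r + \<sigma>\<^sup>2 / 2) * (T - 0)) / (\<sigma> * sqrt (T - 0)) = m / (\<sigma> * q) + \<sigma> * q / 2"
    and d2: "(ln (S0 / K) + (r - \<sigma>\<^sup>2 / 2) * (T - 0)) / (\<sigma> * sqrt (T - 0)) = m / (\<sigma> * q) - \<sigma> * q / 2"
    using q pos unfolding m_def q(2)[symmetric]
    by (simp_all add: q_def[symmetric] field_simps power2_eq_square)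
  show ?thesis
    unfolding BS_def Let_def d1 d2 q_def[symmetric] call_price_def Phi_minus
    using pos disc by (cases cp) (simp_all add: algebra_simps)
qed

text \<open>The implied volatility ranges over \<open>\<sigma> \<ge> 0\<close>, so uniqueness has to
  deal with this intrinsic value as well.\<close>

lemma BS_0:
  fixes r S0 T K :: real
  assumes pos: "S0 > 0" "T > 0" "K > 0"
  defines "m \<equiv> ln (S0 / K) + r * T"
  shows "BS r cp 0 S0 T K 0 =
    S0 * (max (1 - exp (- m)) 0 + (case cp of Call \<Rightarrow> 0 | Put \<Rightarrow> exp (- m) - 1))"
proof -
  have disc: "K * exp (- r * T) = S0 * exp (- m)"
    unfolding m_def using pos by (intro discounted_strike)
  show ?thesis
    using pos disc
    by (cases cp) (simp_all add: BS_def Let_def max_def algebra_simps)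
qed

lemma f_price_eq_call_price:
  assumes "T > 0" "y > 0"
  shows "f_price S0 T m y = S0 * call_price m (y * sqrt T)"
proof -
  define q where "q = sqrt T"
  have q: "q > 0" "q\<^sup>2 = T" using assms by (simp_all add: q_def)
  have "(m + y\<^sup>2 * T / 2) / (y * q) = m / (y * q) + y * q / 2"
    "(m - y\<^sup>2 * T / 2) / (y * q) = m / (y * q) - y * q / 2"
    using q assms unfolding q(2)[symmetric] by (simp_all add: field_simps power2_eq_square)
  then show ?thesis by (simp add: f_price_def call_price_def q_def[symmetric])
qed

lemma gauss_quadrature_sum_weights:
  assumes "prob_space M" "N \<ge> 1" "gauss_quadrature M X N w \<theta>"
  shows "(\<Sum>n=1..N. w n) = 1"
proof -
  interpret prob_space M by fact
  have "(\<integral>\<omega>. poly h (X \<omega>) \<partial>M) = (\<Sum>n=1..N. w n * poly h (\<theta> n))" if "degree h < 2 * N" for h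
    using assms that by (auto simp: gauss_quadrature_def)
  from this[of 1] show ?thesis using \<open>N \<ge> 1\<close> by (simp add: prob_space)
qed

text \<open>The first conjunct shows that the \<open>THE\<close> defining \<open>P\<close> denotes;
  the third shows that the iterated \<open>deriv\<close>, a total operator, yields genuine
  derivatives in the formulas that follow.\<close>

theorem theorem2p5:
  fixes r S0 T K :: real
    and cp :: option_kind
    and D :: "(real ^ 'm) set"
    and \<sigma> :: "real \<Rightarrow> real \<Rightarrow> real ^ 'm \<Rightarrow> real"
    and p :: "real ^ 'm" and i :: 'm
    and M :: "'w measure" and X :: "'w \<Rightarrow> real"
    and N :: nat and w \<theta> \<eta> :: "nat \<Rightarrow> real"
    and P :: "real \<Rightarrow> real" and m_TK :: real and A :: "real set"
    and \<Sigma>\<^sub>0 \<Sigma>\<^sub>2 \<Sigma>\<^sub>4 :: real and H E :: "nat \<Rightarrow> real"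
  assumes "S0 > 0" and "T > 0" and "K > 0"
    and "iv_parametrization D \<sigma>"
    and "continuously_differentiable_in_T_K D \<sigma>"
    and "prob_space M" and "X \<in> borel_measurable M"
    and "N \<ge> 1" and "gauss_quadrature M X N w \<theta>"
    and "\<And>n. n \<in> {1..N} \<Longrightarrow> replace_param p i (\<theta> n) \<in> D"
    and eta: "\<And>n. \<eta> n = \<sigma> T K (replace_param p i (\<theta> n))"
    and "\<And>n. n \<in> {1..N} \<Longrightarrow> \<eta> n > 0"
    and m_TK: "m_TK = ln (S0 / K) + r * T"
    and P: "P = (\<lambda>m. THE y. y > 0 \<and> f_price S0 T m y = g_price S0 T N w \<eta> m)"
    and A: "A = {x. summable (\<lambda>k. (deriv ^^ k) P 0 / fact k * x ^ k)}"
    and Sigma0: "\<Sigma>\<^sub>0 = P 0 * sqrt T / 2"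
    and Sigma2: "\<Sigma>\<^sub>2 = P 0 * (deriv ^^ 2) P 0 * T"
    and Sigma4: "\<Sigma>\<^sub>4 = P 0 * (deriv ^^ 4) P 0 * T"
    and H: "\<And>n. H n = \<eta> n * sqrt T / 2"
    and E: "\<And>n. E n = exp ((\<Sigma>\<^sub>0\<^sup>2 - (H n)\<^sup>2) / 2)"
  shows
    "(\<forall>m. \<exists>!y. y > 0 \<and> f_price S0 T m y = g_price S0 T N w \<eta> m)
     \<and> discretized_randomization r cp S0 \<sigma> p i w \<theta> N T K = P m_TK
     \<and> (\<forall>k x. (deriv ^^ k) P field_differentiable at x)
     \<and> (\<forall>x\<in>A. P x = (\<Sum>k. (deriv ^^ k) P 0 / fact k * x ^ k))
     \<and> (m_TK \<in> A \<longrightarrow>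
          discretized_randomization r cp S0 \<sigma> p i w \<theta> N T K
            = (\<Sum>k. (deriv ^^ k) P 0 / fact k * m_TK ^ k))
     \<and> (\<lambda>m. P m - (P 0 + (deriv ^^ 2) P 0 / fact 2 * m ^ 2 + (deriv ^^ 4) P 0 / fact 4 * m ^ 4
            + (deriv ^^ 6) P 0 / fact 6 * m ^ 6)) \<in> O[nhds 0](\<lambda>m. m ^ 8)
     \<and> P 0 = 2 / sqrt T * Phi_inv (\<Sum>n=1..N. w n * Phi (\<eta> n * sqrt T / 2))
     \<and> (deriv ^^ 2) P 0 = 1 / (2 * sqrt T) * (- 1 / \<Sigma>\<^sub>0 + (\<Sum>n=1..N. w n * (E n / H n)))
     \<and> (deriv ^^ 4) P 0 = 1 / (8 * sqrt T) *
          ((1 + 6 * \<Sigma>\<^sub>2 + \<Sigma>\<^sub>0 ^ 2 * (- 7 - 6 * \<Sigma>\<^sub>2 + 3 * \<Sigma>\<^sub>2 ^ 2)) / \<Sigma>\<^sub>0 ^ 3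
           + (\<Sum>n=1..N. w n * (E n / H n ^ 3 * (- 1 + 7 * H n ^ 2))))
     \<and> (deriv ^^ 6) P 0 = 1 / (32 * sqrt T) *
          ((- 3 - 45 * \<Sigma>\<^sub>2 + \<Sigma>\<^sub>0 ^ 2 * (90 * \<Sigma>\<^sub>2 + 60 * \<Sigma>\<^sub>4)
              + \<Sigma>\<^sub>0 ^ 4 * \<Sigma>\<^sub>2 * (45 * \<Sigma>\<^sub>2 + 60 * \<Sigma>\<^sub>4 - 15 * \<Sigma>\<^sub>2 ^ 2)) / \<Sigma>\<^sub>0 ^ 5
           + (16 * \<Sigma>\<^sub>0 ^ 2 - 90 * \<Sigma>\<^sub>2 ^ 2 - 31 * \<Sigma>\<^sub>0 ^ 4 - 45 * \<Sigma>\<^sub>0 ^ 2 * \<Sigma>\<^sub>2 ^ 2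
              - \<Sigma>\<^sub>0 ^ 4 * (15 * \<Sigma>\<^sub>2 + 60 * \<Sigma>\<^sub>4) + 15 * \<Sigma>\<^sub>0 ^ 2 * \<Sigma>\<^sub>2 ^ 3) / \<Sigma>\<^sub>0 ^ 5
           + (\<Sum>n=1..N. w n * (E n / H n ^ 5 * (3 - 16 * H n ^ 2 + 31 * H n ^ 4))))"
proof -
  define q where "q = sqrt T"
  have q: "q > 0" "q * q = T" using \<open>T > 0\<close> by (simp_all add: q_def)
  have eta_pos: "\<And>n. n \<in> {1..N} \<Longrightarrow> \<eta> n > 0" by fact
  define v where "v = (\<lambda>n. \<eta> n * q)"
  \<comment> \<open>Keeps index ranges in the form \<open>{1..N}\<close>; rewriting 1 to
    \<open>Suc 0\<close> would stop facts about these sums from matching.\<close>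
  note One_nat_def [simp del]
  interpret vol_mixture "{1..N}" w v
  proof
    show "sum w {1..N} = 1"
      by (rule gauss_quadrature_sum_weights) fact+
    show "w n \<ge> 0" if "n \<in> {1..N}" for n
      using \<open>gauss_quadrature M X N w \<theta>\<close> that by (auto simp: gauss_quadrature_def)
    show "v n > 0" if "n \<in> {1..N}" for n
      using eta_pos[OF that] q by (simp add: v_def)
  qed simp
  have f: "f_price S0 T m y = S0 * call_price m (y * q)" if "y > 0" for m y
    using f_price_eq_call_price[OF \<open>T > 0\<close> that] by (simp add: q_def)
  have g: "g_price S0 T N w \<eta> m = S0 * mixture_price m" for m
  proof -
    have "g_price S0 T N w \<eta> m = (\<Sum>n=1..N. w n * f_price S0 T m (\<eta> n))"
      by (simp add: g_price_def f_price_def sum_distrib_left mult_ac)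
    also have "\<dots> = (\<Sum>n=1..N. w n * (S0 * call_price m (v n)))"
      by (intro sum.cong refl) (simp add: f eta_pos v_def)
    finally show ?thesis unfolding mixture_price_def sum_distrib_left by (simp only: mult_ac)
  qed
  \<comment> \<open>A solution \<open>y\<close> is a volatility, \<open>y * q\<close> the
    corresponding total volatility; hence the division by \<open>q\<close>.\<close>
  have sol_iff: "y > 0 \<and> f_price S0 T m y = g_price S0 T N w \<eta> m \<longleftrightarrow> y = mixture_vol m / q" for m y
  proof
    assume y: "y > 0 \<and> f_price S0 T m y = g_price S0 T N w \<eta> m"
    then have "mixture_vol m = y * q"
      using q(1) \<open>S0 > 0\<close> by (intro mixture_vol_eqI) (auto simp: f g)
    then show "y = mixture_vol m / q" using q by simp
  next
    assume y: "y = mixture_vol m / q"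
    then have "y > 0" using q mixture_vol_pos by simp
    then show "y > 0 \<and> f_price S0 T m y = g_price S0 T N w \<eta> m"
      using q y by (simp add: f g call_price_mixture_vol)
  qed
  have unique: "\<forall>m. \<exists>!y. y > 0 \<and> f_price S0 T m y = g_price S0 T N w \<eta> m"
    unfolding sol_iff by simp
  have P_eq: "P = (\<lambda>m. mixture_vol m / q)"
    unfolding P sol_iff by simp

  have P_deriv: "(deriv ^^ k) P = (\<lambda>m. (deriv ^^ k) mixture_vol m / q)" for k
  proof (induction k)
    case (Suc k)
    have "deriv (\<lambda>m. (deriv ^^ k) mixture_vol m / q) x = (deriv ^^ Suc k) mixture_vol x / q" for x
      by (intro DERIV_imp_deriv DERIV_cdivide mixture_vol_has_deriv)
    then show ?case using Suc by simp
  qed (simp add: P_eq)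
  have smooth: "(deriv ^^ k) P field_differentiable at x" for k x
    unfolding P_deriv using mixture_vol_has_deriv DERIV_cdivide field_differentiable_def by blast

  \<comment> \<open>Identification with the Black-Scholes implied volatility\<close>
  have dr: "discretized_randomization r cp S0 \<sigma> p i w \<theta> N T K = P m_TK"
  proof -
    define off where "off = (case cp of Call \<Rightarrow> 0 | Put \<Rightarrow> exp (- m_TK) - 1)"
    have BS: "BS r cp 0 S0 T K y = S0 * (call_price m_TK (y * q) + off)" if "y > 0" for y
      unfolding off_def m_TK q_def
      by (rule BS_eq_call_price[OF \<open>S0 > 0\<close> \<open>T > 0\<close> \<open>K > 0\<close> that])
    have BS0: "BS r cp 0 S0 T K 0 = S0 * (max (1 - exp (- m_TK)) 0 + off)"
      unfolding off_def m_TK by (rule BS_0[OF \<open>S0 > 0\<close> \<open>T > 0\<close> \<open>K > 0\<close>])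
    have "(\<Sum>n=1..N. w n * BS r cp 0 S0 T K (\<sigma> T K (replace_param p i (\<theta> n))))
        = (\<Sum>n=1..N. S0 * (w n * call_price m_TK (v n)) + w n * (S0 * off))"
      by (intro sum.cong refl) (simp add: BS eta_pos v_def algebra_simps flip: eta)
    also have "\<dots> = S0 * (mixture_price m_TK + off)"
      unfolding mixture_price_def sum.distrib sum_distrib_left[symmetric] sum_distrib_right[symmetric] w_sum
      by (simp only: mult_1 distrib_left)
    finally have V: "(\<Sum>n=1..N. w n * BS r cp 0 S0 T K (\<sigma> T K (replace_param p i (\<theta> n))))
        = S0 * (mixture_price m_TK + off)" .
    show ?thesis
      unfolding discretized_randomization_def implied_vol_def V
    proof (rule the_equality)
      have "P m_TK > 0" using q mixture_vol_pos by (simp add: P_eq)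
      then show "P m_TK \<ge> 0 \<and> BS r cp 0 S0 T K (P m_TK) = S0 * (mixture_price m_TK + off)"
        using q by (simp add: BS P_eq call_price_mixture_vol)
    next
      fix y assume y: "y \<ge> 0 \<and> BS r cp 0 S0 T K y = S0 * (mixture_price m_TK + off)"
      \<comment> \<open>At volatility 0 the price is intrinsic, and the price at
        \<open>mixture_vol m_TK\<close> strictly exceeds it.\<close>
      have "y \<noteq> 0"
        using y BS0 \<open>S0 > 0\<close> call_price_greater_intrinsic[OF mixture_vol_pos, of m_TK m_TK]
        by (auto simp: call_price_mixture_vol)
      then have "y > 0" using y by simp
      then have "mixture_vol m_TK = y * q"
        using q(1) y \<open>S0 > 0\<close> by (intro mixture_vol_eqI) (auto simp: BS)
      then show "y = P m_TK" using q by (simp add: P_eq)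
    qed
  qed

  \<comment> \<open>Taylor series and remainder\<close>
  have P_ra: "\<exists>h. real_extends_at h P x" for x
  proof -
    obtain h where h: "real_extends_at h mixture_vol x"
      using mixture_vol_real_extends by blast
    have "real_extends_at (\<lambda>z. h z / of_real q) P x"
      unfolding real_extends_at_def
    proof
      show "(\<lambda>z. h z / of_real q) analytic_on {of_real x}"
        using h q by (intro analytic_intros) (auto simp: real_extends_at_def)
      have "\<forall>\<^sub>F y in nhds x. h (of_real y) = of_real (mixture_vol y)"
        using h by (simp add: real_extends_at_def)
      then show "\<forall>\<^sub>F y in nhds x. h (of_real y) / of_real q = of_real (P y)"
        by eventually_elim (simp add: P_eq)
    qed
    then show ?thesis by blast
  qed
  have taylor: "P x = (\<Sum>k. (deriv ^^ k) P 0 / fact k * x ^ k)" if "x \<in> A" for x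
    using that by (intro real_analytic_eq_taylor_series P_ra) (simp add: A)

  have odd: "(deriv ^^ k) P 0 = 0" if "odd k" for k
    using mixture_vol_odd_deriv_0[OF that] by (simp add: P_deriv)
  \<comment> \<open>The derivative of order 7 vanishes too, which is why the remainder has order
    8.\<close>
  have "(\<Sum>k<8. (deriv ^^ k) P 0 / fact k * m ^ k)
      = P 0 + (deriv ^^ 2) P 0 / fact 2 * m ^ 2 + (deriv ^^ 4) P 0 / fact 4 * m ^ 4
            + (deriv ^^ 6) P 0 / fact 6 * m ^ 6" for m
  proof -
    have "{..<8::nat} = {0, 1, 2, 3, 4, 5, 6, 7}" by auto
    then show ?thesis using odd[of 1] odd[of 3] odd[of 5] odd[of 7] by simp
  qed
  then have bigo: "(\<lambda>m. P m - (P 0 + (deriv ^^ 2) P 0 / fact 2 * m ^ 2 + (deriv ^^ 4) P 0 / fact 4 * m ^ 4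
            + (deriv ^^ 6) P 0 / fact 6 * m ^ 6)) \<in> O[nhds 0](\<lambda>m. m ^ 8)"
    using taylor_remainder_bigo[of P 8] smooth by simp

  \<comment> \<open>Closed forms of the derivatives at 0\<close>
  define s where "s = mixture_vol 0"
  define b where "b = (deriv ^^ 2) mixture_vol 0 / fact 2"
  define c where "c = (deriv ^^ 4) mixture_vol 0 / fact 4"
  define d where "d = (deriv ^^ 6) mixture_vol 0 / fact 6"
  define M1 where "M1 = (\<Sum>n=1..N. w n * (E n / H n))"
  define M3 where "M3 = (\<Sum>n=1..N. w n * (E n / H n ^ 3))"
  define M5 where "M5 = (\<Sum>n=1..N. w n * (E n / H n ^ 5))"
  have s: "s > 0" by (simp add: s_def mixture_vol_pos)
  have H_pos: "H n > 0" if "n \<in> {1..N}" for n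
    using eta_pos[OF that] q by (simp add: H q_def)
  have v_H: "v n = 2 * H n" for n by (simp add: v_def H q_def)
  \<comment> \<open>The factors 2, 24, 720 are 2!, 4!, 6!, as \<open>b\<close>, \<open>c\<close>,
    \<open>d\<close> are Taylor coefficients.\<close>
  have derivs: "P 0 = s / q" "(deriv ^^ 2) P 0 = 2 * b / q" "(deriv ^^ 4) P 0 = 24 * c / q"
    "(deriv ^^ 6) P 0 = 720 * d / q"
    by (simp add: P_eq s_def) (simp_all add: P_deriv b_def c_def d_def fact_numeral)
  have \<Sigma>: "\<Sigma>\<^sub>0 = s / 2" "\<Sigma>\<^sub>2 = s * (2 * b)" "\<Sigma>\<^sub>4 = s * (24 * c)"
    using q unfolding Sigma0 Sigma2 Sigma4 derivs q_def[symmetric] by (simp_all flip: q(2))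
  have P0: "P 0 = 2 / sqrt T * Phi_inv (\<Sum>n=1..N. w n * Phi (\<eta> n * sqrt T / 2))"
  proof -
    have "Phi_inv (\<Sum>n=1..N. w n * Phi (\<eta> n * sqrt T / 2)) = Phi_inv (Phi (s / 2))"
      unfolding s_def Phi_mixture_vol_0 by (simp add: v_def q_def)
    also have "\<dots> = s / 2"
      by (rule inv_f_f) (rule strict_mono_imp_inj_on[OF strict_mono_Phi])
    finally show ?thesis by (simp add: derivs q_def)
  qed
  have E_eq: "exp ((s\<^sup>2 - (v n)\<^sup>2) / 8) = E n" for n
    unfolding E \<Sigma> v_H by (rule arg_cong[where f = exp]) (simp add: power2_eq_square field_simps)
  have h5: "x ^ 5 = x * x ^ 4" for x :: real
    using power_add[of x 1 4] by simp
  \<comment> \<open>With \<open>v n = 2 * H n\<close>, the factors 1/v, 1/(2 v^3), 1/(8 v^5) become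
    1/(2 H), 1/(16 H^3), 1/(256 H^5) in \<open>k0\<close>, \<open>k2\<close>,
    \<open>k4\<close>.\<close>
  have k0: "(\<Sum>n=1..N. w n / v n * exp (((mixture_vol 0)\<^sup>2 - (v n)\<^sup>2) / 8)) = M1 / 2"
    unfolding s_def[symmetric] E_eq M1_def sum_divide_distrib unfolding v_H
    by (intro sum.cong refl) simp
  have k2: "(\<Sum>n=1..N. w n / v n * exp (((mixture_vol 0)\<^sup>2 - (v n)\<^sup>2) / 8) * (- 1 / (2 * (v n)\<^sup>2))) = - M3 / 16"
    unfolding s_def[symmetric] E_eq M3_def sum_divide_distrib sum_negf[symmetric] unfolding v_H
    by (intro sum.cong refl) (simp add: power2_eq_square power3_eq_cube)
  have k4: "(\<Sum>n=1..N. w n / v n * exp (((mixture_vol 0)\<^sup>2 - (v n)\<^sup>2) / 8) * (1 / (8 * v n ^ 4))) = M5 / 256"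
    unfolding s_def[symmetric] E_eq M5_def sum_divide_distrib unfolding v_H
    by (intro sum.cong refl) (simp add: h5 power_mult_distrib)
  note coeffs = mixture_vol_coefficients[folded b_def c_def d_def, unfolded k0 k2 k4, folded s_def]
  have closed:
    "2 * b = 1 / 2 * (- 1 / \<Sigma>\<^sub>0 + M1)"
    "24 * c = 1 / 8 * ((1 + 6 * \<Sigma>\<^sub>2 + \<Sigma>\<^sub>0 ^ 2 * (- 7 - 6 * \<Sigma>\<^sub>2 + 3 * \<Sigma>\<^sub>2 ^ 2)) / \<Sigma>\<^sub>0 ^ 3 + (7 * M1 - M3))"
    "720 * d = 1 / 32 *
          ((- 3 - 45 * \<Sigma>\<^sub>2 + \<Sigma>\<^sub>0 ^ 2 * (90 * \<Sigma>\<^sub>2 + 60 * \<Sigma>\<^sub>4)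
              + \<Sigma>\<^sub>0 ^ 4 * \<Sigma>\<^sub>2 * (45 * \<Sigma>\<^sub>2 + 60 * \<Sigma>\<^sub>4 - 15 * \<Sigma>\<^sub>2 ^ 2)) / \<Sigma>\<^sub>0 ^ 5
           + (16 * \<Sigma>\<^sub>0 ^ 2 - 90 * \<Sigma>\<^sub>2 ^ 2 - 31 * \<Sigma>\<^sub>0 ^ 4 - 45 * \<Sigma>\<^sub>0 ^ 2 * \<Sigma>\<^sub>2 ^ 2
              - \<Sigma>\<^sub>0 ^ 4 * (15 * \<Sigma>\<^sub>2 + 60 * \<Sigma>\<^sub>4) + 15 * \<Sigma>\<^sub>0 ^ 2 * \<Sigma>\<^sub>2 ^ 3) / \<Sigma>\<^sub>0 ^ 5
           + (3 * M5 - 16 * M3 + 31 * M1))"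
    unfolding \<Sigma> by (rule vol_coefficients_closed_form[OF s]; use coeffs in simp)+
  have sum4: "(\<Sum>n=1..N. w n * (E n / H n ^ 3 * (- 1 + 7 * H n ^ 2))) = 7 * M1 - M3"
  proof -
    have "(\<Sum>n=1..N. w n * (E n / H n ^ 3 * (- 1 + 7 * H n ^ 2)))
        = (\<Sum>n=1..N. 7 * (w n * (E n / H n)) - w n * (E n / H n ^ 3))"
      using H_pos by (intro sum.cong refl) (force simp: field_simps power2_eq_square power3_eq_cube)
    then show ?thesis by (simp add: M1_def M3_def sum_subtractf sum_distrib_left)
  qed
  have sum6: "(\<Sum>n=1..N. w n * (E n / H n ^ 5 * (3 - 16 * H n ^ 2 + 31 * H n ^ 4))) = 3 * M5 - 16 * M3 + 31 * M1"
  proof -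
    have "(\<Sum>n=1..N. w n * (E n / H n ^ 5 * (3 - 16 * H n ^ 2 + 31 * H n ^ 4)))
        = (\<Sum>n=1..N. 3 * (w n * (E n / H n ^ 5)) - 16 * (w n * (E n / H n ^ 3)) + 31 * (w n * (E n / H n)))"
      using H_pos by (intro sum.cong refl) (force simp: field_simps h5 power4_eq_xxxx power2_eq_square power3_eq_cube)
    then show ?thesis by (simp add: M1_def M3_def M5_def sum.distrib sum_subtractf sum_distrib_left)
  qed
  \<comment> \<open>Passing from total volatility back to \<open>P\<close> adds 1/sqrt T to the
    prefactors 1/2, 1/8, 1/32.\<close>
  have scale: "x / q = 1 / (k * sqrt T) * y" if "x = 1 / k * y" for x y k :: real
    using that by (simp add: q_def)
  have P2: "(deriv ^^ 2) P 0 = 1 / (2 * sqrt T) * (- 1 / \<Sigma>\<^sub>0 + (\<Sum>n=1..N. w n * (E n / H n)))"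
    unfolding derivs M1_def[symmetric] by (rule scale[OF closed(1)])
  note P4 = scale[OF closed(2), folded derivs sum4]
  note P6 = scale[OF closed(3), folded derivs sum6]
  show ?thesis
    using unique dr smooth taylor bigo P0 P2 P4 P6 by simp
qed

end
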